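(* Let $r>1$ and let $\{\gamma_{1,k}\}_{k=0}^\infty,\{\gamma_{2,k}\}_{k=0}^\infty\subset[\gamma_{\min},\gamma_{\max}]$ with $\gamma_{\max}\ge\gamma_{\min}>0$. Assume: (1) $f:\mathbb{S}^n\to(-\infty,\infty]$ is continuously differentiable on $\operatorname{int}\operatorname{dom}f$, bounded from below on $\mathbb{S}^n_+$, and lower semicontinuous; (2) $\mathbb{S}^n_{++}\subset\operatorname{int}\operatorname{dom}f$ and $\operatorname{dom}f\cap\mathbb{S}^n_+\subset\operatorname{int}\operatorname{dom}f$; (3) $\nabla f$ is locally Lipschitz continuous on $\operatorname{int}\operatorname{dom}f$. For $k\ge0$, $X\in\mathbb{S}^n$, $Y\in\mathbb{S}^n_{++}$, let $$D_k(X,Y):=\gamma_{1,k}\det(Y)^r\left(-\log\frac{\det(X)}{\det(Y)}+\langle X,Y^{-1}\rangle-n\right)+\frac{\gamma_{2,k}}{2}\|X-Y\|^2.$$ Let $\{X^k\}$ be a sequence generated by the algorithm GVDPGM (defined in the context) with these distances $D_k$, applied to the problem of minimizing $f(X)$ over $X\in\mathbb{S}^n_+$ (i.e. with $\mathbb{E}=\mathbb{S}^n$, $g=\delta_{\mathbb{S}^n_+}$, $\mathcal{C}=\mathbb{S}^n_{++}$). Then any accumulation point $X^*$ of $\{X^k\}$ is an F-stationary point of $\min_{X\in\mathbb{S}^n_+}f(X)$, i.e. $X^*\in\operatorname{dom}f\cap\mathbb{S}^n_+$ and $0\in\widehat{\partial}(f+\delta_{\mathbb{S}^n_+})(X^*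 )$.
   Context: $\mathbb{S}^n$ is the space of real symmetric $n\times n$ matrices with inner product $\langle X,Y\rangle=\operatorname{tr}(XY)$ and induced norm $\|\cdot\|$; $\mathbb{S}^n_+$ is the cone of positive semidefinite matrices and $\mathbb{S}^n_{++}$ its interior. Convention: $D_k(X,Y)=\infty$ if $X\notin\mathbb{S}^n_{++}$ (i.e. $-\log\det(X)=\infty$ there). $\delta_{\mathcal A}$ is the indicator function of $\mathcal A$ ($0$ on $\mathcal A$, $\infty$ elsewhere); $\operatorname{dom}\phi:=\{x:\phi(x)<\infty\}$; $\operatorname{int}$ denotes interior. Algorithm GVDPGM (generalized variable distance proximal gradient method) for minimizing $F=f+g$: input $x^0\in\mathcal{C}\cap\operatorname{dom}g$, $F_0=F(x^0)$, $\beta>1$, $0<\sigma<1$, $0<p\le1$. For $k=0,1,2,\dots$ (run without termination): find the smallest $i\in\{0,1,2,\dots\}$ such that $F(x^{k,i})\le F_k-\sigma\beta^iD_k(x^{k,i},x^k)$, where $x^{k,i}$ is some element of $\operatorname{argmin}_{x\in\mathbb{E}}\{f(x^k)+\langle\nabla f(x^k),x-x^k\rangle+\beta^iD_k(x,x^k)+g(x)\}$. Denote this $i$ by $i_k$, choose $p_{k+1}\in[p,1]$, and set $x^{k+1}=x^{k,i_k}$, $F_{k+1}=p_{k+1}F(x^{k+1})+(1-p_{k+1})F_k$. Fréchet subdifferential at $x\in\operatorname{dom}\phi$: $\widehat{\partial}\phi(x)=\{v:\liminf_{y\to x,\,y\neq x}\frac{\phi(y)-\phi(x)-\langle v,y-x\rangle}{\|y-x\|}\ge0\}$.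 *)

theory Defs
  imports "HOL-Analysis.Analysis"
begin

section \<open>The Euclidean space of real symmetric matrices\<close>

typedef ('n::finite) symmat = "{A :: real^'n^'n. transpose A = A}"
  morphisms mat_of symmat_of
  by (rule exI[of _ 0]) (simp add: transpose_def vec_eq_iff)

setup_lifting type_definition_symmat

lemma transpose_mat_of [simp]: "transpose (mat_of X) = mat_of X"
  using mat_of[of X] by simp

lemma transpose_add_mat: "transpose (A + B :: real^'n^'m) = transpose A + transpose B"
  by (simp add: transpose_def vec_eq_iff)

lemma trace_mult_symmetric:
  fixes A B :: "real^'n^'n"
  assumes "transpose A = A"
  shows "trace (A ** B) = A \<bullet> B"
proof -
  have "A $ i $ k = A $ k $ i" for i k
    using assms by (metis transpose_def vec_lambda_beta)
  then have "trace (A ** B) = (\<Sum>i\<in>UNIV. \<Sum>k\<in>UNIV. A $ k $ i * B $ k $ i)"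
    unfolding trace_def matrix_matrix_mult_def by (simp cong: sum.cong)
  also have "\<dots> = (\<Sum>k\<in>UNIV. \<Sum>i\<in>UNIV. A $ k $ i * B $ k $ i)"
    by (rule sum.swap)
  finally show ?thesis
    by (simp add: inner_vec_def)
qed

instantiation symmat :: (finite) real_inner
begin

lift_definition zero_symmat :: "'a symmat" is 0
  by (simp add: transpose_def vec_eq_iff)

lift_definition plus_symmat :: "'a symmat \<Rightarrow> 'a symmat \<Rightarrow> 'a symmat" is "(+)"
  by (simp add: transpose_add_mat)

lift_definition minus_symmat :: "'a symmat \<Rightarrow> 'a symmat \<Rightarrow> 'a symmat" is "(-)"
  by (simp add: transpose_def vec_eq_iff)

lift_definition uminus_symmat :: "'a symmat \<Rightarrow> 'a symmat" is uminus
  by (simp add: transpose_def vec_eq_iff)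

lift_definition scaleR_symmat :: "real \<Rightarrow> 'a symmat \<Rightarrow> 'a symmat" is "(*\<^sub>R)"
  by (simp add: transpose_scalar)

definition inner_symmat :: "'a symmat \<Rightarrow> 'a symmat \<Rightarrow> real" where
  "inner_symmat X Y = trace (mat_of X ** mat_of Y)"

definition norm_symmat :: "'a symmat \<Rightarrow> real" where
  "norm_symmat X = sqrt (inner X X)"

definition dist_symmat :: "'a symmat \<Rightarrow> 'a symmat \<Rightarrow> real" where
  "dist_symmat X Y = norm (X - Y)"

definition sgn_symmat :: "'a symmat \<Rightarrow> 'a symmat" where
  "sgn_symmat X = scaleR (inverse (norm X)) X"

definition uniformity_symmat :: "('a symmat \<times> 'a symmat) filter" where
  "uniformity_symmat = (INF e\<in>{0<..}. principal {(X, Y). dist X Y < e})"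

definition open_symmat :: "'a symmat set \<Rightarrow> bool" where
  "open_symmat U = (\<forall>X\<in>U. eventually (\<lambda>(X', Y). X' = X \<longrightarrow> Y \<in> U) uniformity)"

instance
proof
  fix X Y Z :: "'a symmat" and a b :: real
  have eq: "V \<bullet> W = mat_of V \<bullet> mat_of W" for V W :: "'a symmat"
    by (simp add: inner_symmat_def trace_mult_symmetric)
  show "X + Y + Z = X + (Y + Z)" by transfer (simp add: add.assoc)
  show "X + Y = Y + X" by transfer (simp add: add.commute)
  show "0 + X = X" by transfer simp
  show "- X + X = 0" by transfer simp
  show "X - Y = X + - Y" by transfer simp
  show "a *\<^sub>R (X + Y) = a *\<^sub>R X + a *\<^sub>R Y" by transfer (simp add: scaleR_add_right)
  show "(a + b) *\<^sub>R X = a *\<^sub>R X + b *\<^sub>R X" by transfer (simp add: scaleR_add_left)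
  show "a *\<^sub>R b *\<^sub>R X = (a * b) *\<^sub>R X" by transfer simp
  show "1 *\<^sub>R X = X" by transfer simp
  show "sgn X = inverse (norm X) *\<^sub>R X" by (rule sgn_symmat_def)
  show "dist X Y = norm (X - Y)" by (rule dist_symmat_def)
  show "uniformity = (INF e\<in>{0<..}. principal {(X, Y :: 'a symmat). dist X Y < e})"
    by (rule uniformity_symmat_def)
  show "open U = (\<forall>X\<in>U. \<forall>\<^sub>F (X', Y) in uniformity. X' = X \<longrightarrow> Y \<in> U)" for U :: "'a symmat set"
    by (rule open_symmat_def)
  show "X \<bullet> Y = Y \<bullet> X" by (simp add: eq inner_commute)
  show "(X + Y) \<bullet> Z = X \<bullet> Z + Y \<bullet> Z"
    by (simp add: eq plus_symmat.rep_eq inner_add_left)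
  show "(a *\<^sub>R X) \<bullet> Y = a * (X \<bullet> Y)" by (simp add: eq scaleR_symmat.rep_eq)
  show "0 \<le> X \<bullet> X" by (simp add: eq)
  show "(X \<bullet> X = 0) = (X = 0)"
    by (simp add: eq mat_of_inject[symmetric] zero_symmat.rep_eq)
  show "norm X = sqrt (X \<bullet> X)" by (rule norm_symmat_def)
qed

end

lemma inner_symmat_eq: "X \<bullet> Y = mat_of X \<bullet> mat_of Y"
  by (simp add: inner_symmat_def trace_mult_symmetric)

lemma norm_symmat_eq: "norm X = norm (mat_of X)"
  by (simp add: norm_eq_sqrt_inner inner_symmat_eq)

lemma subspace_symmetric: "subspace {A :: real^'n^'n. transpose A = A}"
  by (auto simp: subspace_def transpose_add_mat transpose_scalar) (simp add: transpose_def vec_eq_iff)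

lemma symmat_orthonormal_basis_exists:
  "\<exists>B :: 'n::finite symmat set. B \<noteq> {} \<and> finite B \<and>
     (\<forall>u\<in>B. \<forall>v\<in>B. u \<bullet> v = (if u = v then 1 else 0)) \<and>
     (\<forall>x. (\<forall>u\<in>B. x \<bullet> u = 0) \<longleftrightarrow> x = 0)"
proof -
  let ?S = "{A :: real^'n^'n. transpose A = A}"
  obtain B where B: "B \<subseteq> ?S" "pairwise orthogonal B" "\<And>x. x \<in> B \<Longrightarrow> norm x = 1"
      "independent B" "card B = dim ?S" "span B = ?S"
    by (rule orthonormal_basis_subspace[OF subspace_symmetric]) (rule that; blast)
  define C where "C = symmat_of ` B"
  have mat: "mat_of (symmat_of b) = b" if "b \<in> B" for b
    using symmat_of_inverse B(1) that by blast
  have fin: "finite B"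
    using B(4) independent_imp_finite by blast
  have orth: "u \<bullet> v = (if u = v then 1 else 0)" if uv: "u \<in> C" "v \<in> C" for u v
  proof -
    obtain a b where ab: "a \<in> B" "b \<in> B" "u = symmat_of a" "v = symmat_of b"
      using uv unfolding C_def by blast
    have "u \<bullet> v = a \<bullet> b" using ab mat by (simp add: inner_symmat_eq)
    moreover have "u = v \<longleftrightarrow> a = b" using ab mat by metis
    moreover have "a \<bullet> a = 1" using B(3)[OF ab(1)] by (simp add: dot_square_norm)
    moreover have "a \<noteq> b \<Longrightarrow> a \<bullet> b = 0"
      using B(2) ab by (simp add: pairwise_def orthogonal_def)
    ultimately show ?thesis by auto
  qed
  have zero: "x = 0" if "\<forall>u\<in>C. x \<bullet> u = 0" for x
  proof -
    have "orthogonal (mat_of x) b" if "b \<in> B" for b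
    proof -
      have "x \<bullet> symmat_of b = 0"
        using \<open>\<forall>u\<in>C. x \<bullet> u = 0\<close> that by (simp add: C_def)
      then show ?thesis
        using mat[OF that] by (simp add: inner_symmat_eq orthogonal_def)
    qed
    moreover have "mat_of x \<in> span B"
      using B(6) by simp
    ultimately have "orthogonal (mat_of x) (mat_of x)"
      using orthogonal_to_span by blast
    then show ?thesis
      by (simp add: orthogonal_def mat_of_inject[symmetric] zero_symmat.rep_eq)
  qed
  have "C \<noteq> {}"
  proof
    assume "C = {}"
    then have "\<forall>x :: 'n symmat. x = 0" using zero by simp
    then have "symmat_of (mat 1 :: real^'n^'n) = 0" by (rule spec)
    then have "mat_of (symmat_of (mat 1 :: real^'n^'n)) = 0" by (simp add: zero_symmat.rep_eq)
    then have "(mat 1 :: real^'n^'n) = 0" by (simp add: symmat_of_inverse transpose_mat)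
    then have "trace (mat 1 :: real^'n^'n) = 0" by (simp add: trace_def)
    then show False by (simp add: trace_I)
  qed
  then show ?thesis
  proof (intro exI[of _ C] conjI)
    show "finite C" using fin by (simp add: C_def)
    show "\<forall>u\<in>C. \<forall>v\<in>C. u \<bullet> v = (if u = v then 1 else 0)" using orth by simp
    show "\<forall>x. (\<forall>u\<in>C. x \<bullet> u = 0) \<longleftrightarrow> x = 0" using zero by auto
  qed
qed

instantiation symmat :: (finite) euclidean_space
begin

definition Basis_symmat :: "'a symmat set" where
  "Basis_symmat = (SOME B. B \<noteq> {} \<and> finite B \<and>
     (\<forall>u\<in>B. \<forall>v\<in>B. u \<bullet> v = (if u = v then 1 else 0)) \<and>
     (\<forall>x. (\<forall>u\<in>B. x \<bullet> u = 0) \<longleftrightarrow> x = 0))"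

instance
proof -
  have "(Basis :: 'a symmat set) \<noteq> {} \<and> finite (Basis :: 'a symmat set) \<and>
      (\<forall>u\<in>Basis. \<forall>v\<in>Basis :: 'a symmat set. u \<bullet> v = (if u = v then 1 else 0)) \<and>
      (\<forall>x :: 'a symmat. (\<forall>u\<in>Basis. x \<bullet> u = 0) \<longleftrightarrow> x = 0)"
    unfolding Basis_symmat_def
    by (rule someI_ex[OF symmat_orthonormal_basis_exists])
  then show "OFCLASS('a symmat, euclidean_space_class)"
    by intro_classes auto
qed

end

definition psd_cone :: "'n::finite symmat set" where
  "psd_cone = {X. \<forall>v. 0 \<le> v \<bullet> (mat_of X *v v)}"

definition pd_cone :: "'n::finite symmat set" where
  "pd_cone = interior psd_cone"


section \<open>Extended-real-valued functions\<close>

definition edomain :: "('a \<Rightarrow> ereal) \<Rightarrow> 'a set" where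
  "edomain \<phi> = {x. \<phi> x < \<infinity>}"

definition indicator_inf :: "'a set \<Rightarrow> 'a \<Rightarrow> ereal" where
  "indicator_inf A x = (if x \<in> A then 0 else \<infinity>)"

definition lower_semicontinuous :: "('a::topological_space \<Rightarrow> ereal) \<Rightarrow> bool" where
  "lower_semicontinuous \<phi> \<longleftrightarrow> (\<forall>x. \<phi> x \<le> Liminf (at x) \<phi>)"

text \<open>Only meaningful where \<open>\<phi>\<close> is finite near \<open>x\<close>, since \<open>real_of_ereal\<close> sends infinite values to 0.\<close>
definition gradient :: "('a::real_inner \<Rightarrow> ereal) \<Rightarrow> 'a \<Rightarrow> 'a" where
  "gradient \<phi> x = (THE v. GDERIV (\<lambda>y. real_of_ereal (\<phi> y)) x :> v)"

definition continuously_differentiable_on :: "('a::real_inner \<Rightarrow> ereal) \<Rightarrow> 'a set \<Rightarrow> bool" where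
  "continuously_differentiable_on \<phi> U \<longleftrightarrow>
     (\<forall>x\<in>U. \<exists>v. GDERIV (\<lambda>y. real_of_ereal (\<phi> y)) x :> v) \<and> continuous_on U (gradient \<phi>)"

definition locally_lipschitz_on :: "('a::metric_space \<Rightarrow> 'b::metric_space) \<Rightarrow> 'a set \<Rightarrow> bool" where
  "locally_lipschitz_on h U \<longleftrightarrow> (\<forall>x\<in>U. \<exists>u>0. \<exists>L. L-lipschitz_on (cball x u \<inter> U) h)"

definition frechet_subdifferential :: "('a::real_inner \<Rightarrow> ereal) \<Rightarrow> 'a \<Rightarrow> 'a set" where
  "frechet_subdifferential \<phi> x = {v. x \<in> edomain \<phi> \<and>
     Liminf (at x) (\<lambda>y. (\<phi> y - \<phi> x - ereal (v \<bullet> (y - x))) / ereal (norm (y - x))) \<ge> 0}"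


section \<open>The generalized variable distance proximal gradient method\<close>

definition prox_grad_model ::
  "('a::real_inner \<Rightarrow> ereal) \<Rightarrow> ('a \<Rightarrow> ereal) \<Rightarrow> ('a \<Rightarrow> 'a \<Rightarrow> ereal) \<Rightarrow> real \<Rightarrow> 'a \<Rightarrow> 'a \<Rightarrow> ereal"
  where "prox_grad_model f g d \<tau> y x =
    f y + ereal (gradient f y \<bullet> (x - y)) + ereal \<tau> * d x y + g x"

text \<open>
  \<open>xt k i\<close> is the trial point $x^{k,i}$, \<open>bt k\<close> the number $i_k$ of backtracking steps and
  \<open>Fv k\<close> the reference value $F_k$. Trial points are only constrained for \<open>i \<le> bt k\<close>, the ones
  that the line search actually computes.
\<close>
definition GVDPGM_sequence ::
  "('a::real_inner \<Rightarrow> ereal) \<Rightarrow> ('a \<Rightarrow> ereal) \<Rightarrow> 'a set \<Rightarrow> (nat \<Rightarrow> 'a \<Rightarrow> 'a \<Rightarrow> ereal) \<Rightarrow>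
   real \<Rightarrow> real \<Rightarrow> real \<Rightarrow> (nat \<Rightarrow> 'a) \<Rightarrow> bool"
  where "GVDPGM_sequence f g C D \<beta> \<sigma> p x \<longleftrightarrow>
    (let F = (\<lambda>z. f z + g z) in
     x 0 \<in> C \<inter> edomain g \<and>
     (\<exists>(Fv :: nat \<Rightarrow> ereal) (xt :: nat \<Rightarrow> nat \<Rightarrow> 'a) (bt :: nat \<Rightarrow> nat) (pk :: nat \<Rightarrow> real).
        Fv 0 = F (x 0) \<and>
        (\<forall>k. (\<forall>i\<le>bt k. is_arg_min (prox_grad_model f g (D k) (\<beta> ^ i) (x k)) (\<lambda>_. True) (xt k i)) \<and>
             F (xt k (bt k)) \<le> Fv k - ereal (\<sigma> * \<beta> ^ bt k) * D k (xt k (bt k)) (x k) \<and>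
             (\<forall>i<bt k. \<not> F (xt k i) \<le> Fv k - ereal (\<sigma> * \<beta> ^ i) * D k (xt k i) (x k)) \<and>
             p \<le> pk (Suc k) \<and> pk (Suc k) \<le> 1 \<and>
             x (Suc k) = xt k (bt k) \<and>
             Fv (Suc k) = ereal (pk (Suc k)) * F (x (Suc k)) + ereal (1 - pk (Suc k)) * Fv k)))"

text \<open>
  The inner product $\langle X, Y^{-1} \rangle$ is written as a trace, because the inverse lives in
  the type of all square matrices. For \<open>X\<close> and \<open>Y\<close> in \<open>pd_cone\<close> all determinants are positive.
\<close>
definition logdet_distance ::
  "real \<Rightarrow> real \<Rightarrow> real \<Rightarrow> 'n::finite symmat \<Rightarrow> 'n symmat \<Rightarrow> ereal"
  where "logdet_distance r \<gamma>1 \<gamma>2 X Y =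
    (if X \<in> pd_cone then
       ereal (\<gamma>1 * det (mat_of Y) powr r *
                (- ln (det (mat_of X) / det (mat_of Y))
                 + trace (mat_of X ** matrix_inv (mat_of Y)) - real CARD('n))
              + \<gamma>2 / 2 * (norm (X - Y))\<^sup>2)
     else \<infinity>)"

end

theory Submission
  imports Defs
begin

text \<open>
  The reference values $F_k$ decrease and are bounded below, so $\|X^{k+1} - X^k\| \to 0$. Near an
  accumulation point $X^*$ the gradient is Lipschitz, so the line search succeeds as soon as
  $\beta^i$ exceeds a constant, and the step parameters $\tau_k = \beta^{i_k}$ stay bounded along the
  subsequence. Testing the optimality condition
  \[ \nabla f(X^k) + \tau_k \bigl(\gamma_{1,k} \det(X^k)^r ((X^k)^{-1} - (X^{k+1})^{-1})
     + \gamma_{2,k} (X^{k+1} - X^k)\bigr) = 0 \]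
  with the direction $Z - X^{k+1}$ for $Z \succeq 0$ and passing to the limit gives
  $\langle \nabla f(X^*), Z - X^* \rangle \ge 0$: either $\det X^* > 0$ and the difference of inverses
  vanishes, or $\det(X^k)^r (X^k)^{-1} \to 0$ while
  $\langle (X^{k+1})^{-1}, Z \rangle \ge 0$ has the right sign.
\<close>

section \<open>Determinants and positive definite matrices\<close>

lemma matrix_inv_mult:
  fixes A :: "real^'n^'n"
  assumes "invertible A"
  shows "A ** matrix_inv A = mat 1" "matrix_inv A ** A = mat 1"
  using someI_ex[OF assms[unfolded invertible_def]] unfolding matrix_inv_def by auto

lemma transpose_matrix_inv:
  fixes A :: "real^'n^'n"
  assumes "invertible A" "transpose A = A"
  shows "transpose (matrix_inv A) = matrix_inv A"
proof -
  have "transpose (matrix_inv A) ** A = mat 1"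
    using arg_cong[OF matrix_inv_mult(1)[OF assms(1)], of transpose] assms(2)
    by (simp add: matrix_transpose_mul transpose_mat)
  then have "(transpose (matrix_inv A) ** A) ** matrix_inv A = mat 1 ** matrix_inv A"
    by simp
  then show ?thesis
    by (simp add: matrix_mul_assoc[symmetric] matrix_inv_mult(1)[OF assms(1)])
qed

lemma matrix_add_rdistrib:
  fixes A B :: "'a::semiring_1^'n^'m"
  shows "(A + B) ** C = A ** C + B ** C"
  by (simp add: vec_eq_iff matrix_matrix_mult_def distrib_right sum.distrib)

text \<open>Differentiate the Leibniz expansion term by term. A permutation other than the identity
  moves at least two points, so after one factor has been differentiated another one still vanishes
  at 0; the identity alone contributes and yields the trace.\<close>

lemma has_field_derivative_det_mat_1:
  fixes B :: "real^'n^'n"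
  shows "((\<lambda>t. det (mat 1 + t *\<^sub>R B)) has_field_derivative trace B) (at 0)"
proof -
  let ?P = "{p. p permutes (UNIV :: 'n set)}"
  let ?\<delta> = "\<lambda>i j. if i = j then 1 else 0 :: real"
  have *: "((\<lambda>t. \<Prod>i\<in>UNIV. ?\<delta> i (p i) + t * B$i$p i) has_field_derivative
        (\<Sum>j\<in>UNIV. B$j$p j * (\<Prod>i\<in>UNIV - {j}. ?\<delta> i (p i)))) (at 0)" for p :: "'n \<Rightarrow> 'n"
  proof -
    have "((\<lambda>t. ?\<delta> i (p i) + t * B$i$p i) has_field_derivative B$i$p i) (at 0)" for i
      by (auto intro!: derivative_eq_intros)
    from has_field_derivative_prod[OF this, where A = UNIV] show ?thesis by simp
  qed
  have zero: "(\<Prod>i\<in>UNIV - {j}. ?\<delta> i (p i)) = 0" if "p permutes UNIV" "p \<noteq> id" for p :: "'n \<Rightarrow> 'n" and j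
  proof -
    have "\<exists>i. i \<noteq> j \<and> p i \<noteq> i"
    proof (rule ccontr)
      assume "\<nexists>i. i \<noteq> j \<and> p i \<noteq> i"
      then have fixed: "p i = i" if "i \<noteq> j" for i using that by blast
      have "p j \<noteq> j" using fixed that(2) by (metis eq_id_iff)
      then have "p (p j) = p j" by (rule fixed)
      with \<open>p j \<noteq> j\<close> show False using permutes_inj[OF that(1)] by (auto dest: injD)
    qed
    then obtain i where "i \<in> UNIV - {j}" "p i \<noteq> i" by auto
    then show ?thesis by (intro prod_zero) (auto intro!: bexI[of _ i])
  qed
  have det: "det (mat 1 + t *\<^sub>R B) = (\<Sum>p\<in>?P. of_int (sign p) * (\<Prod>i\<in>UNIV. ?\<delta> i (p i) + t * B$i$p i))" for t
    by (simp add: det_def mat_def)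
  have "((\<lambda>t. det (mat 1 + t *\<^sub>R B)) has_field_derivative
     (\<Sum>p\<in>?P. of_int (sign p) * (\<Sum>j\<in>UNIV. B$j$p j * (\<Prod>i\<in>UNIV - {j}. ?\<delta> i (p i))))) (at 0)"
    unfolding det by (intro DERIV_sum DERIV_cmult *)
  also have "(\<Sum>p\<in>?P. of_int (sign p) * (\<Sum>j\<in>UNIV. B$j$p j * (\<Prod>i\<in>UNIV - {j}. ?\<delta> i (p i))))
     = (\<Sum>p\<in>{id}. of_int (sign p) * (\<Sum>j\<in>UNIV. B$j$p j * (\<Prod>i\<in>UNIV - {j}. ?\<delta> i (p i))))"
    by (rule sum.mono_neutral_right) (auto simp: zero finite_permutations permutes_id)
  also have "\<dots> = trace B" by (simp add: trace_def sign_id)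
  finally show ?thesis .
qed

text \<open>Jacobi's formula. With M = A + tH, factoring A + (t + s)H = M (I + s M^{-1} H) reduces
  it to the derivative at the identity.\<close>

lemma has_field_derivative_det_line:
  fixes A H :: "real^'n^'n"
  assumes "invertible (A + t *\<^sub>R H)"
  shows "((\<lambda>s. det (A + s *\<^sub>R H)) has_field_derivative
           det (A + t *\<^sub>R H) * trace (matrix_inv (A + t *\<^sub>R H) ** H)) (at t)"
proof -
  let ?M = "A + t *\<^sub>R H"
  have "det (A + (t + s) *\<^sub>R H) = det ?M * det (mat 1 + s *\<^sub>R (matrix_inv ?M ** H))" for s
  proof -
    have "A + (t + s) *\<^sub>R H = ?M ** (mat 1 + s *\<^sub>R (matrix_inv ?M ** H))"
      by (simp add: matrix_add_ldistrib matrix_mul_assoc matrix_inv_mult[OF assms] scaleR_left_distrib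
          matrix_scalar_ac flip: scalar_matrix_assoc)
    then show ?thesis by (simp only: det_mul)
  qed
  then have "((\<lambda>s. det (A + (t + s) *\<^sub>R H)) has_field_derivative
           det ?M * trace (matrix_inv ?M ** H)) (at 0)"
    by (simp add: DERIV_cmult has_field_derivative_det_mat_1)
  then show ?thesis
    using DERIV_shift[of "\<lambda>s. det (A + s *\<^sub>R H)" _ 0 t] by (simp add: add.commute)
qed

section \<open>Definite matrices and concavity of the log-determinant\<close>

definition psd :: "real^'n^'n \<Rightarrow> bool" where
  "psd A \<longleftrightarrow> (\<forall>v. 0 \<le> v \<bullet> (A *v v))"

definition posdef :: "real^'n^'n \<Rightarrow> bool" where
  "posdef A \<longleftrightarrow> transpose A = A \<and> (\<forall>v. v \<noteq> 0 \<longrightarrow> 0 < v \<bullet> (A *v v))"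

lemma symmetric_inner_swap:
  fixes A :: "real^'n^'n"
  assumes "transpose A = A"
  shows "x \<bullet> (A *v y) = (A *v x) \<bullet> y"
  by (metis assms dot_lmul_matrix transpose_matrix_vector)

text \<open>Symmetric Gaussian elimination: a positive pivot splits off a rank-one matrix w w^T / a,
  whose inner product with \<open>Q\<close> is w^T Q w / a, and the remainder is again positive
  semidefinite. The induction runs over a set \<open>S\<close> containing every index with a nonzero
  diagonal entry.\<close>

lemma inner_psd_psd_nonneg:
  fixes P Q :: "real^'n^'n"
  assumes "transpose P = P" "psd P" "psd Q"
  shows "0 \<le> P \<bullet> Q"
proof -
  have "0 \<le> P \<bullet> Q" if "finite S" "transpose P = P" "psd P" "\<forall>i. i \<notin> S \<longrightarrow> P$i$i = 0"
    for S and P :: "real^'n^'n"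
    using that
  proof (induction S arbitrary: P rule: finite_induct)
    case empty
    \<comment> \<open>With a zero diagonal, testing s e_i + e_j leaves the linear term 2 s P_ij,
      which can be nonnegative for both signs of s only if P_ij = 0.\<close>
    have "P$i$j = 0" for i j
    proof -
      have sym: "P$i$j = P$j$i"
        using empty(1) by (metis transpose_def vec_lambda_beta)
      have "0 \<le> (s *\<^sub>R axis i 1 + axis j 1) \<bullet> (P *v (s *\<^sub>R axis i 1 + axis j 1))" for s :: real
        using empty(2) unfolding psd_def by blast
      moreover have "(s *\<^sub>R axis i 1 + axis j 1) \<bullet> (P *v (s *\<^sub>R axis i 1 + axis j 1)) = 2 * s * P$i$j" for s :: real
        using empty(3) sym
        by (simp add: matrix_vector_right_distrib matrix_vector_mult_scaleR matrix_vector_mul_component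
            inner_add_left inner_add_right inner_axis' matrix_vector_mult_basis column_def)
      ultimately have "0 \<le> 2 * s * P$i$j" for s :: real by simp
      from this[of 1] this[of "-1"] show ?thesis by simp
    qed
    then have "P = 0" by (simp add: vec_eq_iff)
    then show ?case by simp
  next
    case (insert i S)
    define a where "a = P$i$i"
    define w where "w = P *v axis i 1"
    have wi: "w $ k = P$k$i" for k by (simp add: w_def matrix_vector_mult_basis column_def)
    have "0 \<le> axis i 1 \<bullet> (P *v axis i 1)" using insert.prems(2) unfolding psd_def by blast
    then have "0 \<le> a" using wi by (simp add: a_def inner_axis' flip: w_def)
    show ?case
    proof (cases "a = 0")
      case True
      then show ?thesis using insert by (metis a_def insertE)
    next
      case False
      with \<open>0 \<le> a\<close> have a: "a > 0" by simp
      \<comment> \<open>\<open>W\<close> is w w^T for the pivot column w, and \<open>P'\<close> is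
        the Schur complement of the pivot \<open>a\<close>, padded by a zero row and column.\<close>
      define W :: "real^'n^'n" where "W = (\<chi> k l. w$k * w$l)"
      define P' where "P' = P - (1/a) *\<^sub>R W"
      have W: "v \<bullet> (W *v v) = (v \<bullet> w)\<^sup>2" for v
        by (simp add: W_def inner_vec_def matrix_vector_mult_def power2_eq_square sum_product
            sum_distrib_left mult_ac)
      have WQ: "W \<bullet> Q = w \<bullet> (Q *v w)"
        by (simp add: W_def inner_vec_def matrix_vector_mult_def sum_distrib_left mult_ac)
      have "transpose P' = P'"
        using insert.prems(1) by (simp add: P'_def W_def transpose_def vec_eq_iff mult.commute)
      moreover have psd': "psd P'"
        unfolding psd_def
      proof
        fix v
        \<comment> \<open>This \<open>c\<close> minimizes the quadratic form of \<open>P\<close>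
          along v - c e_i; the minimum is the quadratic form of \<open>P'\<close> at v.\<close>
        define c where "c = (v \<bullet> w) / a"
        have "0 \<le> (v - c *\<^sub>R axis i 1) \<bullet> (P *v (v - c *\<^sub>R axis i 1))"
          using insert.prems(2) unfolding psd_def by blast
        also have "\<dots> = v \<bullet> (P *v v) - 2 * c * (v \<bullet> w) + c * c * a"
          using symmetric_inner_swap[OF insert.prems(1), of "axis i 1" v] wi[of i]
          by (simp add: matrix_vector_mult_diff_distrib matrix_vector_mult_scaleR inner_diff_left
              inner_diff_right inner_axis inner_axis' a_def inner_commute algebra_simps flip: w_def)
        also have "\<dots> = v \<bullet> (P *v v) - (v \<bullet> w)\<^sup>2 / a"
          using a by (simp add: c_def power2_eq_square field_simps)
        also have "\<dots> = v \<bullet> (P' *v v)"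
          by (simp add: P'_def matrix_vector_mult_diff_rdistrib inner_diff_right W
              flip: scaleR_matrix_vector_assoc)
        finally show "0 \<le> v \<bullet> (P' *v v)" .
      qed
      moreover have "\<forall>j. j \<notin> S \<longrightarrow> P'$j$j = 0"
      proof (intro allI impI)
        fix j assume j: "j \<notin> S"
        have P'j: "P'$j$j = P$j$j - (w$j)\<^sup>2 / a" by (simp add: P'_def W_def power2_eq_square)
        show "P'$j$j = 0"
        proof (cases "j = i")
          case True
          then show ?thesis using a wi[of i] P'j by (simp add: a_def power2_eq_square)
        next
          case False
          \<comment> \<open>Off the pivot, P_jj = 0 makes P'_jj equal to -w_j^2 / a, while
            semidefiniteness of \<open>P'\<close> makes it nonnegative.\<close>
          have "0 \<le> axis j 1 \<bullet> (P' *v axis j 1)" using psd' unfolding psd_def by blast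
          then have "0 \<le> P'$j$j" by (simp add: inner_axis' matrix_vector_mult_basis column_def)
          moreover have "P$j$j = 0" using insert.prems(3) j False by simp
          moreover have "0 \<le> (w$j)\<^sup>2 / a" using a by simp
          ultimately show ?thesis using P'j by linarith
        qed
      qed
      ultimately have "0 \<le> P' \<bullet> Q" by (rule insert.IH)
      moreover have "P \<bullet> Q = P' \<bullet> Q + (w \<bullet> (Q *v w)) / a"
        by (simp add: P'_def inner_diff_left WQ)
      moreover have "0 \<le> w \<bullet> (Q *v w)" using assms(3) by (simp add: psd_def)
      ultimately show ?thesis using a by simp
    qed
  qed
  from this[of UNIV P] assms show ?thesis by simp
qed

lemma posdef_imp_psd: "posdef A \<Longrightarrow> psd A"
  unfolding posdef_def psd_def by (metis inner_zero_left less_eq_real_def)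

lemma posdef_invertible:
  assumes "posdef A"
  shows "invertible A"
proof -
  have "x = 0" if "A *v x = 0" for x
  proof (rule ccontr)
    assume "x \<noteq> 0"
    then have "0 < x \<bullet> (A *v x)" using assms by (simp add: posdef_def)
    with that show False by simp
  qed
  then show ?thesis
    by (metis invertible_left_inverse matrix_left_invertible_ker)
qed

lemma psd_matrix_inv:
  assumes "posdef A"
  shows "psd (matrix_inv A)"
  unfolding psd_def
proof
  fix v
  define u where "u = matrix_inv A *v v"
  have v: "v = A *v u"
    by (simp add: u_def matrix_vector_mul_assoc matrix_inv_mult[OF posdef_invertible[OF assms]])
  have "v \<bullet> (matrix_inv A *v v) = u \<bullet> (A *v u)"
    using v by (simp add: u_def inner_commute)
  then show "0 \<le> v \<bullet> (matrix_inv A *v v)"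
    using posdef_imp_psd[OF assms] by (simp add: psd_def)
qed

lemma posdef_convex:
  fixes A B :: "real^'n^'n"
  assumes "posdef A" "posdef B" "0 \<le> t" "t \<le> 1"
  shows "posdef (A + t *\<^sub>R (B - A))"
  unfolding posdef_def
proof (intro conjI allI impI)
  show "transpose (A + t *\<^sub>R (B - A)) = A + t *\<^sub>R (B - A)"
    using assms(1,2) by (simp add: posdef_def transpose_def vec_eq_iff)
next
  fix v :: "real^'n" assume v: "v \<noteq> 0"
  have "v \<bullet> ((A + t *\<^sub>R (B - A)) *v v) = (1 - t) * (v \<bullet> (A *v v)) + t * (v \<bullet> (B *v v))"
    by (simp add: matrix_vector_mult_add_rdistrib matrix_vector_mult_diff_rdistrib inner_add_right
        inner_diff_right algebra_simps flip: scaleR_matrix_vector_assoc)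
  moreover have "0 < v \<bullet> (A *v v)" "0 < v \<bullet> (B *v v)" using assms(1,2) v by (auto simp: posdef_def)
  ultimately show "0 < v \<bullet> ((A + t *\<^sub>R (B - A)) *v v)"
    using assms(3,4) by (cases "t = 0") (auto intro!: add_nonneg_pos)
qed

lemma posdef_mat_1: "posdef (mat 1)"
  by (simp add: posdef_def)

text \<open>Homotopy to the identity: the whole segment is positive definite, hence invertible, so
  the continuous determinant cannot change sign from its value 1 at the identity.\<close>

lemma posdef_det_pos:
  fixes A :: "real^'n^'n"
  assumes "posdef A"
  shows "0 < det A"
proof (rule ccontr)
  define g where "g t = det (mat 1 + t *\<^sub>R (A - mat 1))" for t
  assume "\<not> 0 < det A"
  then have "g 1 \<le> 0" "0 \<le> g 0" by (auto simp: g_def)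
  have pd: "posdef (mat 1 + t *\<^sub>R (A - mat 1))" if "0 \<le> t" "t \<le> 1" for t
    using posdef_convex[OF posdef_mat_1 assms that] .
  have "isCont g t" if "0 \<le> t" "t \<le> 1" for t
    unfolding g_def
    by (rule DERIV_isCont[OF has_field_derivative_det_line]) (rule posdef_invertible[OF pd[OF that]])
  then obtain t where "0 \<le> t" "t \<le> 1" "g t = 0"
    using IVT2[of g 1 0 0] \<open>g 1 \<le> 0\<close> \<open>0 \<le> g 0\<close> by auto
  with pd[of t] show False
    using posdef_invertible invertible_det_nz unfolding g_def by blast
qed

lemma has_field_derivative_ln_det_line:
  fixes A H :: "real^'n^'n"
  assumes "posdef (A + t *\<^sub>R H)"
  shows "((\<lambda>s. ln (det (A + s *\<^sub>R H))) has_field_derivative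
           trace (matrix_inv (A + t *\<^sub>R H) ** H)) (at t)"
  using posdef_det_pos[OF assms]
  by (auto intro!: derivative_eq_intros has_field_derivative_det_line posdef_invertible[OF assms])

text \<open>
  Concavity of \<open>ln \<circ> det\<close>: the derivative along the segment is antitone since
  $\operatorname{tr}(Y^{-1} H A^{-1} H) \ge 0$ for positive definite \<open>Y\<close> and \<open>A\<close>.
\<close>
lemma ln_det_le_trace:
  fixes X Y :: "real^'n^'n"
  assumes X: "posdef X" and Y: "posdef Y"
  shows "ln (det X / det Y) \<le> trace (X ** matrix_inv Y) - CARD('n)"
proof -
  define H where "H = X - Y"
  define A where "A t = Y + t *\<^sub>R H" for t
  have pd: "posdef (A t)" if "0 \<le> t" "t \<le> 1" for t
    using posdef_convex[OF Y X that] by (simp add: A_def H_def)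
  have "\<exists>z>0. z < 1 \<and> ln (det (A 1)) - ln (det (A 0)) = (1 - 0) * trace (matrix_inv (A z) ** H)"
    by (rule MVT2) (use has_field_derivative_ln_det_line pd in \<open>auto simp: A_def\<close>)
  then obtain z where z: "0 < z" "z < 1"
    and mvt: "ln (det X) - ln (det Y) = trace (matrix_inv (A z) ** H)"
    by (auto simp: A_def H_def)
  let ?Y = "matrix_inv Y" and ?A = "matrix_inv (A z)"
  have pdz: "posdef (A z)" using pd z by simp
  note invA = matrix_inv_mult[OF posdef_invertible[OF pdz]]
  note invY = matrix_inv_mult[OF posdef_invertible[OF Y]]
  have symH: "transpose H = H"
    using X Y by (simp add: H_def posdef_def transpose_def vec_eq_iff)
  \<comment> \<open>Congruence by the symmetric \<open>H\<close> preserves semidefiniteness, so the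
    trace inequality for semidefinite pairs applies to Y^{-1} and H A(z)^{-1} H.\<close>
  have "psd (H ** ?A ** H)"
    unfolding psd_def
  proof
    fix v
    have "v \<bullet> ((H ** ?A ** H) *v v) = (H *v v) \<bullet> (?A *v (H *v v))"
      using symmetric_inner_swap[OF symH, of v] by (simp flip: matrix_vector_mul_assoc)
    then show "0 \<le> v \<bullet> ((H ** ?A ** H) *v v)"
      using psd_matrix_inv[OF pdz] by (simp add: psd_def)
  qed
  moreover have symY: "transpose ?Y = ?Y"
    using Y by (intro transpose_matrix_inv posdef_invertible) (auto simp: posdef_def)
  ultimately have nonneg: "0 \<le> trace (?Y ** (H ** ?A ** H))"
    using inner_psd_psd_nonneg[OF symY psd_matrix_inv[OF Y]] by (simp add: trace_mult_symmetric)
  \<comment> \<open>Resolvent identity: Y^{-1} - A(z)^{-1} = Y^{-1} (A(z) - Y) A(z)^{-1}, where A(z)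
    - Y = zH. It compares the slope at z with the slope at 0.\<close>
  have "?Y - ?A = ?Y ** (A z) ** ?A - ?Y ** Y ** ?A"
    by (simp add: invA invY flip: matrix_mul_assoc)
  also have "\<dots> = z *\<^sub>R (?Y ** H ** ?A)"
    by (simp add: A_def matrix_add_ldistrib matrix_add_rdistrib matrix_scalar_ac flip: scalar_matrix_assoc)
  finally have diff: "?Y = ?A + z *\<^sub>R (?Y ** H ** ?A)" by (simp add: algebra_simps)
  have "trace (?Y ** H) = trace (?A ** H) + z * trace (?Y ** (H ** ?A ** H))"
    by (subst diff) (simp add: matrix_add_rdistrib trace_add trace_def sum_distrib_left sum.distrib
       matrix_mul_assoc flip: scalar_matrix_assoc)
  with nonneg z have "trace (?A ** H) \<le> trace (?Y ** H)" by simp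
  also have "\<dots> = trace (?Y ** X) - trace (?Y ** Y)"
    by (simp add: H_def trace_sub[symmetric] matrix_matrix_mult_def right_diff_distrib sum_subtractf
        trace_def)
  also have "\<dots> = trace (X ** ?Y) - CARD('n)"
    by (simp add: invY trace_I trace_mul_sym[of X])
  finally show ?thesis
    using mvt posdef_det_pos[OF X] posdef_det_pos[OF Y] by (simp add: ln_div)
qed

text \<open>Written in the form of Cramer's rule: column k is replaced by e_j. The entries are
  polynomials in \<open>A\<close>, so the adjugate still converges where the inverse blows
  up.\<close>

definition adjugate :: "real^'n^'n \<Rightarrow> real^'n^'n" where
  "adjugate A = (\<chi> k j. det (\<chi> i l. if l = k then axis j 1 $ i else A$i$l))"

lemma matrix_inv_adjugate:
  fixes A :: "real^'n^'n"
  assumes "det A \<noteq> 0"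
  shows "matrix_inv A = (1 / det A) *\<^sub>R adjugate A"
proof -
  have inv: "invertible A" using assms invertible_det_nz by blast
  have "matrix_inv A $ k $ j = adjugate A $ k $ j / det A" for k j
  proof -
    have "A *v (matrix_inv A *v axis j 1) = axis j 1"
      by (simp add: matrix_vector_mul_assoc matrix_inv_mult[OF inv])
    then have "matrix_inv A *v axis j 1 =
        (\<chi> k. det (\<chi> i l. if l = k then axis j 1 $ i else A$i$l) / det A)"
      by (simp only: cramer[OF assms])
    then have "(matrix_inv A *v axis j 1) $ k = adjugate A $ k $ j / det A"
      by (simp add: adjugate_def)
    then show ?thesis by (simp add: matrix_vector_mult_basis column_def)
  qed
  then show ?thesis by (simp add: vec_eq_iff)
qed

lemma tendsto_det:
  fixes A :: "'a \<Rightarrow> real^'n^'n"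
  assumes "(A \<longlongrightarrow> L) F"
  shows "((\<lambda>x. det (A x)) \<longlongrightarrow> det L) F"
  unfolding det_def by (intro tendsto_intros assms)

lemma tendsto_adjugate:
  fixes A :: "'a \<Rightarrow> real^'n^'n"
  assumes "(A \<longlongrightarrow> L) F"
  shows "((\<lambda>x. adjugate (A x)) \<longlongrightarrow> adjugate L) F"
  unfolding adjugate_def
  by (intro tendsto_vec_lambda tendsto_det) (auto intro!: tendsto_intros assms)

section \<open>The cone of symmetric matrices and the log-determinant distance\<close>

lemma bounded_linear_mat_of: "bounded_linear mat_of"
  by (rule bounded_linear_intro[where K = 1])
    (auto simp: plus_symmat.rep_eq scaleR_symmat.rep_eq norm_symmat_eq)

lemmas tendsto_mat_of = bounded_linear.tendsto[OF bounded_linear_mat_of]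

lemma tendsto_trace_mult:
  fixes A B :: "'a \<Rightarrow> real^'n^'n"
  assumes "(A \<longlongrightarrow> L) F" "(B \<longlongrightarrow> M) F"
  shows "((\<lambda>x. trace (A x ** B x)) \<longlongrightarrow> trace (L ** M)) F"
  unfolding trace_def matrix_matrix_mult_def by (simp, intro tendsto_intros assms)

lemma psd_cone_iff: "X \<in> psd_cone \<longleftrightarrow> psd (mat_of X)"
  by (simp add: psd_cone_def psd_def)

lemma closed_psd_cone: "closed (psd_cone :: 'n::finite symmat set)"
proof -
  have "closed {X :: 'n symmat. 0 \<le> v \<bullet> (mat_of X *v v)}" for v
    by (intro closed_Collect_le continuous_intros
        bounded_linear.continuous_on[OF bounded_linear_mat_of]
        continuous_on_inner) (auto simp: matrix_vector_mult_def
          intro!: continuous_intros bounded_linear.continuous_on[OF bounded_linear_mat_of])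
  then have "closed (\<Inter>v. {X :: 'n symmat. 0 \<le> v \<bullet> (mat_of X *v v)})" by blast
  moreover have "psd_cone = (\<Inter>v. {X :: 'n symmat. 0 \<le> v \<bullet> (mat_of X *v v)})"
    by (auto simp: psd_cone_def)
  ultimately show ?thesis by simp
qed

lemma open_pd_cone: "open pd_cone"
  by (simp add: pd_cone_def)

lemma pd_cone_subset_psd_cone: "pd_cone \<subseteq> psd_cone"
  by (simp add: pd_cone_def interior_subset)

text \<open>Subtracting a small multiple tI from an interior point stays in the cone, whence v^T X v
  \<ge> t |v|^2.\<close>

lemma pd_cone_posdef:
  fixes X :: "'n::finite symmat"
  assumes "X \<in> pd_cone"
  shows "posdef (mat_of X)"
  unfolding posdef_def
proof (intro conjI allI impI)
  show "transpose (mat_of X) = mat_of X" by simp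
  fix v :: "real^'n" assume v: "v \<noteq> 0"
  define I :: "'n symmat" where "I = symmat_of (mat 1)"
  have I: "mat_of I = mat 1" by (simp add: I_def symmat_of_inverse)
  obtain e where e: "e > 0" "ball X e \<subseteq> psd_cone"
    using assms unfolding pd_cone_def mem_interior by blast
  define t where "t = e / (norm I + 1)"
  have t: "t > 0" using e by (simp add: t_def add_nonneg_pos)
  have "t * (norm I + 1) = e" using norm_ge_zero[of I] by (simp add: t_def add_nonneg_eq_0_iff)
  then have "t * norm I < e" using t by (simp add: algebra_simps)
  then have "X - t *\<^sub>R I \<in> psd_cone" using e(2) t by (auto simp: dist_norm)
  then have "0 \<le> v \<bullet> (mat_of (X - t *\<^sub>R I) *v v)" by (simp add: psd_cone_def)
  also have "\<dots> = v \<bullet> (mat_of X *v v) - t * (v \<bullet> v)"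
    by (simp add: minus_symmat.rep_eq scaleR_symmat.rep_eq I matrix_vector_mult_diff_rdistrib
        inner_diff_right flip: scaleR_matrix_vector_assoc)
  moreover have "0 < t * (v \<bullet> v)" using t v by simp
  ultimately show "0 < v \<bullet> (mat_of X *v v)" by linarith
qed

text \<open>The finite branch of \<open>logdet_distance\<close>, on which derivatives can be taken
  in the reals.\<close>

definition logdet_real :: "real \<Rightarrow> real \<Rightarrow> real \<Rightarrow> 'n::finite symmat \<Rightarrow> 'n symmat \<Rightarrow> real" where
  "logdet_real r \<gamma>1 \<gamma>2 X Y = \<gamma>1 * det (mat_of Y) powr r *
                (- ln (det (mat_of X) / det (mat_of Y))
                 + trace (mat_of X ** matrix_inv (mat_of Y)) - real CARD('n))
              + \<gamma>2 / 2 * (norm (X - Y))\<^sup>2"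

lemma logdet_distance_pd: "X \<in> pd_cone \<Longrightarrow> logdet_distance r \<gamma>1 \<gamma>2 X Y = ereal (logdet_real r \<gamma>1 \<gamma>2 X Y)"
  by (simp add: logdet_distance_def logdet_real_def)

text \<open>The log-determinant part is a Bregman distance, nonnegative by concavity of ln det. The
  surviving quadratic term controls the step length throughout the convergence proof.\<close>

lemma logdet_real_ge:
  assumes "X \<in> pd_cone" "Y \<in> pd_cone" "0 \<le> \<gamma>1"
  shows "\<gamma>2 / 2 * (norm (X - Y))\<^sup>2 \<le> logdet_real r \<gamma>1 \<gamma>2 X Y"
  using ln_det_le_trace[OF assms(1,2)[THEN pd_cone_posdef]] assms(3)
  by (simp add: logdet_real_def)

lemma logdet_real_self:
  assumes "Y \<in> pd_cone"
  shows "logdet_real r \<gamma>1 \<gamma>2 Y Y = 0"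
  using posdef_det_pos[OF pd_cone_posdef[OF assms]]
    matrix_inv_mult[OF posdef_invertible[OF pd_cone_posdef[OF assms]]]
  by (simp add: logdet_real_def trace_I)

lemma has_field_derivative_logdet_real:
  fixes X Y H :: "'n::finite symmat"
  assumes "X \<in> pd_cone" "Y \<in> pd_cone"
  shows "((\<lambda>t. logdet_real r \<gamma>1 \<gamma>2 (X + t *\<^sub>R H) Y) has_field_derivative
     \<gamma>1 * det (mat_of Y) powr r * (trace (mat_of H ** matrix_inv (mat_of Y)) -
        trace (mat_of H ** matrix_inv (mat_of X))) + \<gamma>2 * ((X - Y) \<bullet> H)) (at 0)"
proof -
  let ?X = "mat_of X" and ?Y = "mat_of Y" and ?H = "mat_of H"
  have pos: "0 < det ?X" "0 < det ?Y"
    using assms by (auto intro: posdef_det_pos pd_cone_posdef)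
  have "((\<lambda>t. det (?X + t *\<^sub>R ?H)) has_field_derivative
           det ?X * trace (?H ** matrix_inv ?X)) (at 0)"
    using has_field_derivative_det_line[of ?X 0 ?H] posdef_invertible[OF pd_cone_posdef[OF assms(1)]]
    by (simp add: trace_mul_sym[of ?H])
  then have 1: "((\<lambda>t. ln (det (?X + t *\<^sub>R ?H) / det ?Y)) has_field_derivative
           trace (?H ** matrix_inv ?X)) (at 0)"
    using pos by (auto intro!: derivative_eq_intros)
  have tr: "trace ((?X + t *\<^sub>R ?H) ** B) = trace (?X ** B) + t * trace (?H ** B)" for t B
    by (simp add: matrix_add_rdistrib trace_add trace_def sum_distrib_left sum.distrib flip: scalar_matrix_assoc)
  have nrm: "(norm (X + t *\<^sub>R H - Y))\<^sup>2 = (norm (X - Y))\<^sup>2 + 2 * t * ((X - Y) \<bullet> H) + t\<^sup>2 * (H \<bullet> H)" for t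
    unfolding power2_norm_eq_inner
    by (simp add: inner_diff_left inner_diff_right inner_add_left inner_add_right
        inner_commute power2_eq_square algebra_simps)
  have 2: "((\<lambda>t. a * (- L t + (b + t * c) - n) + \<gamma>2 / 2 * (u + 2 * t * v + t\<^sup>2 * w)) has_field_derivative
      a * (c - l) + \<gamma>2 * v) (at 0)"
    if "(L has_field_derivative l) (at 0)" for L :: "real \<Rightarrow> real" and l a b c n u v w
    by (auto intro!: derivative_eq_intros that)
  show ?thesis
    unfolding logdet_real_def nrm plus_symmat.rep_eq scaleR_symmat.rep_eq tr
    by (rule 2[OF 1])
qed

section \<open>Gradients and subdifferentials\<close>

lemma GDERIV_unique:
  assumes "GDERIV f x :> v" "GDERIV f x :> w"
  shows "v = w"
proof -
  have "(\<lambda>h. h \<bullet> v) = (\<lambda>h. h \<bullet> w)"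
    using assms has_derivative_unique unfolding gderiv_def by blast
  then have "(v - w) \<bullet> v = (v - w) \<bullet> w" by (rule fun_cong)
  then have "(v - w) \<bullet> (v - w) = 0" by (simp add: inner_diff_right)
  then show ?thesis by simp
qed

text \<open>Uniqueness of gradients makes the definite description in \<open>gradient\<close> denote
  the actual derivative.\<close>

lemma continuously_differentiable_on_GDERIV:
  assumes "continuously_differentiable_on \<phi> U" "x \<in> U"
  shows "GDERIV (\<lambda>y. real_of_ereal (\<phi> y)) x :> gradient \<phi> x"
proof -
  obtain v where v: "GDERIV (\<lambda>y. real_of_ereal (\<phi> y)) x :> v"
    using assms unfolding continuously_differentiable_on_def by blast
  have "gradient \<phi> x = v"
    unfolding gradient_def by (intro the_equality v) (rule GDERIV_unique[OF _ v])
  with v show ?thesis by simp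
qed

text \<open>Descent lemma through the mean value theorem on the segment. Bounding the intermediate
  parameter by 1 gives the constant \<open>L\<close> in place of the L/2 obtained by
  integration.\<close>

lemma lipschitz_gradient_upper_bound:
  fixes \<phi> :: "'a::real_inner \<Rightarrow> real"
  assumes "convex S" "\<And>z. z \<in> S \<Longrightarrow> GDERIV \<phi> z :> G z" "L-lipschitz_on S G" "x \<in> S" "y \<in> S"
  shows "\<phi> y \<le> \<phi> x + G x \<bullet> (y - x) + L * (norm (y - x))\<^sup>2"
proof -
  define d where "d = y - x"
  have seg: "x + t *\<^sub>R d \<in> S" if "0 \<le> t" "t \<le> 1" for t
  proof -
    have "x + t *\<^sub>R d = (1 - t) *\<^sub>R x + t *\<^sub>R y" by (simp add: d_def algebra_simps)
    then show ?thesis using convexD_alt[OF assms(1,4,5) that] by simp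
  qed
  have "((\<lambda>t. \<phi> (x + t *\<^sub>R d)) has_field_derivative d \<bullet> G (x + t *\<^sub>R d)) (at t)"
    if "0 \<le> t" "t \<le> 1" for t
  proof -
    have "((\<lambda>t. x + t *\<^sub>R d) has_derivative (\<lambda>h. h *\<^sub>R d)) (at t)"
      by (auto intro!: derivative_eq_intros)
    from has_derivative_compose[OF this assms(2)[OF seg[OF that], unfolded gderiv_def]]
    show ?thesis
      by (simp add: has_field_derivative_def mult_commute_abs)
  qed
  then have "\<exists>z>0. z < 1 \<and> \<phi> (x + 1 *\<^sub>R d) - \<phi> (x + 0 *\<^sub>R d) = (1 - 0) * (d \<bullet> G (x + z *\<^sub>R d))"
    by (intro MVT2) auto
  then obtain z where z: "0 < z" "z < 1" "\<phi> y - \<phi> x = d \<bullet> G (x + z *\<^sub>R d)"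
    by (auto simp: d_def)
  have "d \<bullet> G (x + z *\<^sub>R d) - d \<bullet> G x \<le> norm d * norm (G (x + z *\<^sub>R d) - G x)"
    using norm_cauchy_schwarz[of d "G (x + z *\<^sub>R d) - G x"] by (simp add: inner_diff_right)
  also have "\<dots> \<le> norm d * (L * norm (z *\<^sub>R d))"
    using lipschitz_onD[OF assms(3) seg[of z] assms(4)] z by (auto simp: dist_norm intro!: mult_left_mono)
  also have "\<dots> \<le> norm d * (L * norm d)"
    using z lipschitz_on_nonneg[OF assms(3)]
    by (intro mult_left_mono) (auto simp: mult_left_le_one_le)
  finally show ?thesis
    using z(3) by (simp add: d_def inner_commute power2_eq_square algebra_simps)
qed

text \<open>On \<open>S\<close> the variational inequality removes the linear term from the
  first-order expansion, so the difference quotient is at least -e near x; off \<open>S\<close> it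
  is infinite.\<close>

lemma zero_in_frechet_subdifferential_indicator:
  fixes f :: "'a::real_inner \<Rightarrow> ereal"
  assumes x: "x \<in> interior (edomain f)" "x \<in> S"
    and f: "\<And>z. f z \<noteq> -\<infinity>"
    and der: "GDERIV (\<lambda>y. real_of_ereal (f y)) x :> G"
    and G: "\<And>z. z \<in> S \<Longrightarrow> 0 \<le> G \<bullet> (z - x)"
  shows "0 \<in> frechet_subdifferential (\<lambda>z. f z + indicator_inf S z) x"
proof -
  let ?\<phi> = "\<lambda>y. real_of_ereal (f y)"
  let ?Q = "\<lambda>y. (f y + indicator_inf S y - (f x + indicator_inf S x) - ereal (0 \<bullet> (y - x))) / ereal (norm (y - x))"
  have fin: "f y = ereal (?\<phi> y)" if "y \<in> interior (edomain f)" for y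
    using that f[of y] interior_subset[of "edomain f"] by (cases "f y") (auto simp: edomain_def)
  have dom: "x \<in> edomain (\<lambda>z. f z + indicator_inf S z)"
    using x interior_subset[of "edomain f"] by (auto simp: edomain_def indicator_inf_def)
  have "ereal (- e) \<le> Liminf (at x) ?Q" if e: "e > 0" for e
  proof (rule Liminf_bounded)
    have "eventually (\<lambda>y. y \<in> interior (edomain f)) (at x)"
      using x(1) by (intro eventually_at_in_open') auto
    moreover have "((\<lambda>y. norm (?\<phi> y - ?\<phi> x - (y - x) \<bullet> G) / norm (y - x)) \<longlongrightarrow> 0) (at x)"
      using der unfolding gderiv_def has_derivative_iff_norm by simp
    then have "eventually (\<lambda>y. norm (?\<phi> y - ?\<phi> x - (y - x) \<bullet> G) / norm (y - x) < e) (at x)"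
      using e by (auto dest: order_tendstoD)
    moreover have "eventually (\<lambda>y. y \<noteq> x) (at x)" by (simp add: eventually_at_filter)
    ultimately show "eventually (\<lambda>y. ereal (- e) \<le> ?Q y) (at x)"
    proof eventually_elim
      case (elim y)
      obtain a b where ab: "f x = ereal a" "f y = ereal b"
        using fin[OF x(1)] fin[OF elim(1)] by blast
      show ?case
      proof (cases "y \<in> S")
        case True
        have "norm (y - x) > 0" using elim by simp
        then have "- e * norm (y - x) \<le> ?\<phi> y - ?\<phi> x - (y - x) \<bullet> G"
          using elim(2) by (simp add: field_simps abs_less_iff)
        also have "\<dots> \<le> ?\<phi> y - ?\<phi> x" using G[OF True] by (simp add: inner_commute)
        finally have "- e \<le> (?\<phi> y - ?\<phi> x) / norm (y - x)"
          using \<open>norm (y - x) > 0\<close> by (simp add: field_simps)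
        moreover have "?Q y = ereal ((?\<phi> y - ?\<phi> x) / norm (y - x))"
          using True x elim by (simp add: ab indicator_inf_def)
        ultimately show ?thesis by simp
      next
        case False
        have "?Q y = \<infinity>"
          using False x elim by (simp add: ab indicator_inf_def)
        then show ?thesis by simp
      qed
    qed
  qed
  \<comment> \<open>Moving e to the right-hand side gives the form that
    \<open>ereal_le_epsilon2\<close> expects.\<close>
  then have "ereal (- e) + ereal e \<le> Liminf (at x) ?Q + ereal e" if "e > 0" for e
    using that by (intro add_right_mono) blast
  moreover have "ereal (- e) + ereal e = 0" for e by simp
  ultimately have "0 \<le> Liminf (at x) ?Q + ereal e" if "e > 0" for e
    using that by (simp only:)
  then have "0 \<le> Liminf (at x) ?Q"
    by (rule ereal_le_epsilon2)
  then show ?thesis using dom by (simp add: frechet_subdifferential_def)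
qed

text \<open>The \<open>Liminf\<close> is over a punctured neighbourhood, whereas the sequence may
  hit its limit; the strict inequality at \<open>l\<close> itself fills the gap and passes from
  \<open>at l\<close> to \<open>nhds l\<close>.\<close>

lemma lower_semicontinuous_limit_le:
  fixes \<phi> :: "'a::t1_space \<Rightarrow> ereal"
  assumes "lower_semicontinuous \<phi>" "x \<longlonglongrightarrow> l" "\<And>n. \<phi> (x n) \<le> c"
  shows "\<phi> l \<le> c"
proof (rule ccontr)
  assume "\<not> \<phi> l \<le> c"
  then have c: "c < \<phi> l" by simp
  also have "\<dots> \<le> Liminf (at l) \<phi>" using assms(1) by (simp add: lower_semicontinuous_def)
  finally have "eventually (\<lambda>y. c < \<phi> y) (at l)" by (rule less_LiminfD)
  with c have "eventually (\<lambda>y. c < \<phi> y) (nhds l)" by (simp add: eventually_nhds_conv_at)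
  then have "eventually (\<lambda>n. c < \<phi> (x n)) sequentially"
    using assms(2) by (rule eventually_compose_filterlim)
  then obtain n where "c < \<phi> (x n)" using eventually_happens by force
  with assms(3)[of n] show False by simp
qed

section \<open>Convergence of the proximal gradient method\<close>

text \<open>The infinite distance outside \<open>pd_cone\<close> acts as a barrier: the minimizer
  lies in the open cone, where the derivative vanishes in every direction. The inequality comes from
  comparing with \<open>X\<close> itself, at distance 0.\<close>

lemma logdet_prox_step:
  fixes f :: "'n::finite symmat \<Rightarrow> ereal"
  assumes X: "X \<in> pd_cone" and c: "f X = ereal c" and \<tau>: "\<tau> > 0"
    and min: "is_arg_min (prox_grad_model f (indicator_inf psd_cone) (logdet_distance r \<gamma>1 \<gamma>2) \<tau> X)
        (\<lambda>_. True) Y"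
  shows "Y \<in> pd_cone"
    and "gradient f X \<bullet> (Y - X) + \<tau> * logdet_real r \<gamma>1 \<gamma>2 Y X \<le> 0"
    and "gradient f X \<bullet> H + \<tau> * (\<gamma>1 * det (mat_of X) powr r *
          (trace (mat_of H ** matrix_inv (mat_of X)) - trace (mat_of H ** matrix_inv (mat_of Y)))
          + \<gamma>2 * ((Y - X) \<bullet> H)) = 0"
proof -
  let ?M = "prox_grad_model f (indicator_inf psd_cone) (logdet_distance r \<gamma>1 \<gamma>2) \<tau> X"
  define m where "m W = gradient f X \<bullet> (W - X) + \<tau> * logdet_real r \<gamma>1 \<gamma>2 W X" for W
  have M_pd: "?M W = ereal (c + m W)" if "W \<in> pd_cone" for W
  proof -
    have "indicator_inf psd_cone W = 0"
      using that pd_cone_subset_psd_cone by (auto simp: indicator_inf_def)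
    then show ?thesis
      by (simp add: prox_grad_model_def c m_def logdet_distance_pd[OF that])
  qed
  have M_inf: "?M W = \<infinity>" if "W \<notin> pd_cone" for W
    using that \<tau> by (simp add: prox_grad_model_def c logdet_distance_def indicator_inf_def)
  have le: "?M Y \<le> ?M W" for W
    using min by (simp add: is_arg_min_def not_less)
  show Y: "Y \<in> pd_cone"
  proof (rule ccontr)
    assume "Y \<notin> pd_cone"
    with le[of X] show False by (simp add: M_inf M_pd[OF X])
  qed
  have m_le: "m Y \<le> m W" if "W \<in> pd_cone" for W
    using le[of W] by (simp add: M_pd Y that)
  show "gradient f X \<bullet> (Y - X) + \<tau> * logdet_real r \<gamma>1 \<gamma>2 Y X \<le> 0"
    using m_le[OF X] by (simp add: m_def logdet_real_self[OF X])
  let ?l = "gradient f X \<bullet> H + \<tau> * (\<gamma>1 * det (mat_of X) powr r *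
          (trace (mat_of H ** matrix_inv (mat_of X)) - trace (mat_of H ** matrix_inv (mat_of Y)))
          + \<gamma>2 * ((Y - X) \<bullet> H))"
  have "((\<lambda>t. gradient f X \<bullet> (Y - X) + t * (gradient f X \<bullet> H)
       + \<tau> * logdet_real r \<gamma>1 \<gamma>2 (Y + t *\<^sub>R H) X) has_field_derivative ?l) (at 0)"
    using has_field_derivative_logdet_real[OF Y X, of r \<gamma>1 \<gamma>2 H]
    by (intro DERIV_add DERIV_cmult) (auto intro!: derivative_eq_intros)
  then have der: "((\<lambda>t. m (Y + t *\<^sub>R H)) has_field_derivative ?l) (at 0)"
    by (simp add: m_def inner_add_right inner_diff_right algebra_simps)
  \<comment> \<open>Openness of the cone admits small moves of either sign along \<open>H\<close>,
    so 0 is a two-sided local minimum.\<close>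
  have "((\<lambda>t. Y + t *\<^sub>R H) \<longlongrightarrow> Y + 0 *\<^sub>R H) (nhds (0::real))"
    by (intro tendsto_intros filterlim_ident)
  then have "eventually (\<lambda>t. Y + t *\<^sub>R H \<in> pd_cone) (nhds (0::real))"
    using open_pd_cone Y by (auto dest: topological_tendstoD)
  then obtain e where e: "e > 0" "\<And>t. \<bar>t\<bar> < e \<Longrightarrow> Y + t *\<^sub>R H \<in> pd_cone"
    by (auto simp: eventually_nhds_metric dist_real_def)
  show "?l = 0"
    by (rule DERIV_local_min[OF der e(1)]) (use e(2) m_le in auto)
qed

text \<open>Translates the extended-real algorithm into real inequalities. By induction the iterates
  stay in the cone and the reference values stay finite and above the objective; averaging costs at
  most the factor \<open>p\<close> in the decrease.\<close>

lemma GVDPGM_logdet_invariants: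
  fixes f :: "'n::finite symmat \<Rightarrow> ereal" and X :: "nat \<Rightarrow> 'n symmat"
  assumes \<gamma>: "\<And>k. 0 \<le> \<gamma>1 k" "\<And>k. 0 \<le> \<gamma>2 k"
    and f: "\<And>Z. Z \<in> pd_cone \<Longrightarrow> f Z = ereal (\<phi> Z)"
    and par: "\<beta> > 1" "0 < \<sigma>" "0 < p"
    and alg: "GVDPGM_sequence f (indicator_inf psd_cone) pd_cone
           (\<lambda>k. logdet_distance r (\<gamma>1 k) (\<gamma>2 k)) \<beta> \<sigma> p X"
  obtains v :: "nat \<Rightarrow> real" and xt :: "nat \<Rightarrow> nat \<Rightarrow> 'n symmat" and bt :: "nat \<Rightarrow> nat"
  where "\<And>k. X k \<in> pd_cone" "\<And>k. \<phi> (X k) \<le> v k"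
    and "\<And>k. v (Suc k) \<le> v k - p * (\<sigma> * \<beta> ^ bt k * logdet_real r (\<gamma>1 k) (\<gamma>2 k) (X (Suc k)) (X k))"
    and "\<And>k. X (Suc k) = xt k (bt k)"
    and "\<And>k i. i \<le> bt k \<Longrightarrow> is_arg_min (prox_grad_model f (indicator_inf psd_cone)
            (logdet_distance r (\<gamma>1 k) (\<gamma>2 k)) (\<beta> ^ i) (X k)) (\<lambda>_. True) (xt k i)"
    and "\<And>k i. i < bt k \<Longrightarrow> v k - \<sigma> * \<beta> ^ i * logdet_real r (\<gamma>1 k) (\<gamma>2 k) (xt k i) (X k) < \<phi> (xt k i)"
proof -
  let ?D = "\<lambda>k. logdet_distance r (\<gamma>1 k) (\<gamma>2 k)"
  let ?d = "\<lambda>k. logdet_real r (\<gamma>1 k) (\<gamma>2 k)"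
  let ?F = "\<lambda>z. f z + indicator_inf psd_cone z"
  obtain Fv xt bt pk where X0: "X 0 \<in> pd_cone" and F0: "Fv 0 = ?F (X 0)"
    and all: "\<forall>k. (\<forall>i\<le>bt k. is_arg_min (prox_grad_model f (indicator_inf psd_cone)
               (?D k) (\<beta> ^ i) (X k)) (\<lambda>_. True) (xt k i)) \<and>
        ?F (xt k (bt k)) \<le> Fv k - ereal (\<sigma> * \<beta> ^ bt k) * ?D k (xt k (bt k)) (X k) \<and>
        (\<forall>i<bt k. \<not> ?F (xt k i) \<le> Fv k - ereal (\<sigma> * \<beta> ^ i) * ?D k (xt k i) (X k)) \<and>
        p \<le> pk (Suc k) \<and> pk (Suc k) \<le> 1 \<and> X (Suc k) = xt k (bt k) \<and>
        Fv (Suc k) = ereal (pk (Suc k)) * ?F (X (Suc k)) + ereal (1 - pk (Suc k)) * Fv k"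
    using alg unfolding GVDPGM_sequence_def Let_def by blast
  from all have argmin: "is_arg_min (prox_grad_model f (indicator_inf psd_cone)
            (?D k) (\<beta> ^ i) (X k)) (\<lambda>_. True) (xt k i)" if "i \<le> bt k" for k i
    using that by blast
  from all have dec: "?F (xt k (bt k)) \<le> Fv k - ereal (\<sigma> * \<beta> ^ bt k) * ?D k (xt k (bt k)) (X k)" for k
    by blast
  from all have fail: "\<not> ?F (xt k i) \<le> Fv k - ereal (\<sigma> * \<beta> ^ i) * ?D k (xt k i) (X k)"
    if "i < bt k" for k i
    using that by blast
  from all have pk: "p \<le> pk (Suc k)" "pk (Suc k) \<le> 1" for k by blast+
  from all have XS: "X (Suc k) = xt k (bt k)" for k by blast
  from all have FS: "Fv (Suc k) = ereal (pk (Suc k)) * ?F (X (Suc k)) + ereal (1 - pk (Suc k)) * Fv k" for k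
    by blast
  have F: "?F Z = ereal (\<phi> Z)" if "Z \<in> pd_cone" for Z
    using f[OF that] that pd_cone_subset_psd_cone by (auto simp: indicator_inf_def)
  have xt: "xt k i \<in> pd_cone" if "X k \<in> pd_cone" "i \<le> bt k" for k i
    using logdet_prox_step(1)[OF that(1) f[OF that(1)] _ argmin[OF that(2)]] par(1) by simp
  have d_nonneg: "0 \<le> ?d k Y Z" if "Y \<in> pd_cone" "Z \<in> pd_cone" for k Y Z
    by (rule order_trans[OF _ logdet_real_ge[OF that \<gamma>(1)]]) (use \<gamma>(2)[of k] in simp)
  have step: "X (Suc k) \<in> pd_cone \<and>
      (\<exists>w. Fv (Suc k) = ereal w \<and> \<phi> (X (Suc k)) \<le> w \<and> w \<le> u - p * (\<sigma> * \<beta> ^ bt k * ?d k (X (Suc k)) (X k)))"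
    if Xk: "X k \<in> pd_cone" and u: "Fv k = ereal u" for k u
  proof -
    let ?s = "\<sigma> * \<beta> ^ bt k * ?d k (X (Suc k)) (X k)"
    have XSk: "X (Suc k) \<in> pd_cone" using xt[OF Xk, of "bt k"] XS by simp
    have "\<phi> (X (Suc k)) \<le> u - ?s"
      using dec[of k] by (simp add: F[OF XSk] logdet_distance_pd[OF XSk] u flip: XS)
    moreover have s: "0 \<le> ?s" using d_nonneg[OF XSk Xk] par by simp
    define w where "w = pk (Suc k) * \<phi> (X (Suc k)) + (1 - pk (Suc k)) * u"
    have w: "Fv (Suc k) = ereal w"
      by (simp add: FS F[OF XSk] u w_def)
    \<comment> \<open>\<open>calculation\<close> holds the line-search decrease \<phi>(X_{k+1})
      \<le> u - \<open>?s\<close>. Since \<open>w\<close> is a convex combination of \<phi>(X_{k+1})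
      and u, at least the fraction \<open>p\<close> of that decrease survives, and \<open>w\<close>
      stays above \<phi>(X_{k+1}).\<close>
    have "pk (Suc k) * (u - \<phi> (X (Suc k))) \<ge> p * ?s"
      using calculation s pk[of k] par by (intro mult_mono) auto
    then have 1: "w \<le> u - p * ?s" by (simp add: w_def algebra_simps)
    have "0 \<le> (1 - pk (Suc k)) * (u - \<phi> (X (Suc k)))"
      using calculation s pk[of k] by (intro mult_nonneg_nonneg) auto
    then have "\<phi> (X (Suc k)) \<le> w" by (simp add: w_def algebra_simps)
    with 1 w XSk show ?thesis by blast
  qed
  have inv: "X k \<in> pd_cone \<and> (\<exists>u. Fv k = ereal u \<and> \<phi> (X k) \<le> u)" for k
  proof (induction k)
    case 0
    then show ?case using X0 F0 F[OF X0] by simp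
  next
    case (Suc k)
    then show ?case using step by blast
  qed
  define v where "v k = real_of_ereal (Fv k)" for k
  have v: "Fv k = ereal (v k)" for k using inv[of k] by (auto simp: v_def)
  show ?thesis
  proof (rule that[of v bt xt])
    fix k
    show "X k \<in> pd_cone" "\<phi> (X k) \<le> v k" using inv[of k] v[of k] by auto
    show "v (Suc k) \<le> v k - p * (\<sigma> * \<beta> ^ bt k * ?d k (X (Suc k)) (X k))"
      using step[OF conjunct1[OF inv] v, of k] v[of "Suc k"] by auto
    show "X (Suc k) = xt k (bt k)" by (rule XS)
    fix i
    show "i \<le> bt k \<Longrightarrow> is_arg_min (prox_grad_model f (indicator_inf psd_cone) (?D k) (\<beta> ^ i) (X k)) (\<lambda>_. True) (xt k i)"
      by (rule argmin)
    show "v k - \<sigma> * \<beta> ^ i * ?d k (xt k i) (X k) < \<phi> (xt k i)" if "i < bt k"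
    proof -
      have "xt k i \<in> pd_cone" using xt[of k i] inv[of k] that by simp
      with fail[OF that] show ?thesis by (simp add: F logdet_distance_pd v)
    qed
  qed
qed

lemma tendsto_matrix_inv:
  fixes A :: "'a \<Rightarrow> real^'n^'n"
  assumes A: "(A \<longlongrightarrow> L) F" and L: "det L \<noteq> 0"
  shows "((\<lambda>x. matrix_inv (A x)) \<longlongrightarrow> matrix_inv L) F"
proof -
  have "((\<lambda>x. (1 / det (A x)) *\<^sub>R adjugate (A x)) \<longlongrightarrow> (1 / det L) *\<^sub>R adjugate L) F"
    by (intro tendsto_intros tendsto_det tendsto_adjugate A L)
  moreover have "eventually (\<lambda>x. (1 / det (A x)) *\<^sub>R adjugate (A x) = matrix_inv (A x)) F"
    using tendsto_imp_eventually_ne[OF tendsto_det[OF A] L]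
    by eventually_elim (simp add: matrix_inv_adjugate)
  ultimately show ?thesis
    by (simp add: matrix_inv_adjugate[OF L] tendsto_cong)
qed

lemma trace_psd_cone_inv_nonneg:
  assumes "Z \<in> psd_cone" "X \<in> pd_cone"
  shows "0 \<le> trace (mat_of Z ** matrix_inv (mat_of X))"
  using assms inner_psd_psd_nonneg[of "mat_of Z"] psd_matrix_inv[OF pd_cone_posdef[OF assms(2)]]
  by (simp add: trace_mult_symmetric psd_cone_iff)

text \<open>
  If the limit is singular, the terms of indefinite sign carry the factor
  $\det(X)^r X^{-1} = \det(X)^{r-1} \operatorname{adj}(X)$, which vanishes in the limit because
  \<open>r > 1\<close>.
\<close>
lemma logdet_slope_bound:
  fixes x y :: "nat \<Rightarrow> 'n::finite symmat"
  assumes x: "\<And>j. x j \<in> pd_cone" "x \<longlonglongrightarrow> l" and y: "\<And>j. y j \<in> pd_cone" "y \<longlonglongrightarrow> l"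
    and Z: "Z \<in> psd_cone" and r: "r > 1"
  obtains w where "w \<longlonglongrightarrow> 0"
    and "\<And>j. det (mat_of (x j)) powr r * (trace (mat_of (Z - y j) ** matrix_inv (mat_of (x j)))
           - trace (mat_of (Z - y j) ** matrix_inv (mat_of (y j)))) \<le> w j"
proof -
  let ?d = "\<lambda>j. det (mat_of (x j))" and ?dl = "det (mat_of l)"
  let ?ix = "\<lambda>j. matrix_inv (mat_of (x j))" and ?iy = "\<lambda>j. matrix_inv (mat_of (y j))"
  let ?s = "\<lambda>j. ?d j powr r * (trace (mat_of (Z - y j) ** ?ix j) - trace (mat_of (Z - y j) ** ?iy j))"
  have pos: "0 < ?d j" for j by (intro posdef_det_pos pd_cone_posdef x)
  have dlim: "?d \<longlonglongrightarrow> ?dl" by (intro tendsto_det tendsto_mat_of x)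
  \<comment> \<open>A positive exponent and nonnegative bases are what give convergence when the
    limit determinant is 0.\<close>
  have powlim: "(\<lambda>j. ?d j powr a) \<longlonglongrightarrow> ?dl powr a" if "a > 0" for a
    using that pos by (intro tendsto_powr' dlim tendsto_const) (auto intro!: always_eventually less_imp_le)
  show ?thesis
  proof (cases "?dl = 0")
    case False
    have "?s \<longlonglongrightarrow> ?dl powr r * (trace (mat_of (Z - l) ** matrix_inv (mat_of l))
        - trace (mat_of (Z - l) ** matrix_inv (mat_of l)))"
      using r by (intro tendsto_intros powlim tendsto_trace_mult tendsto_matrix_inv tendsto_mat_of x y False) auto
    then have "?s \<longlonglongrightarrow> 0" by simp
    then show ?thesis by (rule that) simp
  next
    case True
    \<comment> \<open>What remains after dropping the nonpositive terms -tr(Z y^{-1}) and -tr(y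
      x^{-1}). The dimension comes from tr(y y^{-1}).\<close>
    define w where "w j = ?d j powr (r - 1) * trace (mat_of Z ** adjugate (mat_of (x j)))
        + ?d j powr r * CARD('n)" for j
    have "w \<longlonglongrightarrow> ?dl powr (r - 1) * trace (mat_of Z ** adjugate (mat_of l)) + ?dl powr r * CARD('n)"
      unfolding w_def using r
      by (intro tendsto_intros powlim tendsto_trace_mult tendsto_adjugate tendsto_mat_of x) auto
    then have "w \<longlonglongrightarrow> 0" using True by simp
    then show ?thesis
    proof (rule that)
      fix j
      have sub: "trace (mat_of (Z - y j) ** B) = trace (mat_of Z ** B) - trace (mat_of (y j) ** B)" for B
        by (simp add: minus_symmat.rep_eq trace_def matrix_matrix_mult_def left_diff_distrib sum_subtractf)
      have "trace (mat_of (y j) ** ?iy j) = CARD('n)"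
        using y(1)[of j] by (simp add: matrix_inv_mult posdef_invertible pd_cone_posdef trace_I)
      moreover have "0 \<le> trace (mat_of Z ** ?iy j)" "0 \<le> trace (mat_of (y j) ** ?ix j)"
        using trace_psd_cone_inv_nonneg Z x(1) y(1) pd_cone_subset_psd_cone by blast+
      ultimately have "trace (mat_of (Z - y j) ** ?ix j) - trace (mat_of (Z - y j) ** ?iy j)
          \<le> trace (mat_of Z ** ?ix j) + CARD('n)"
        by (simp add: sub)
      then have "?s j \<le> ?d j powr r * (trace (mat_of Z ** ?ix j) + CARD('n))"
        by (intro mult_left_mono) auto
      also have "trace (mat_of Z ** ?ix j) = trace (mat_of Z ** adjugate (mat_of (x j))) / ?d j"
        using pos[of j]
        by (simp add: matrix_inv_adjugate matrix_scalar_ac trace_def sum_divide_distrib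
            flip: scalar_matrix_assoc)
      also have "?d j powr r * (trace (mat_of Z ** adjugate (mat_of (x j))) / ?d j + CARD('n)) = w j"
        using pos[of j] by (simp add: w_def powr_diff field_simps)
      finally show "?s j \<le> w j" .
    qed
  qed
qed

text \<open>A sufficiently large step parameter passes the line-search test. The model inequality
  gives |y - x| \<le> 2B / (\<tau> \<gamma>), so the first \<open>large\<close> bound keeps y in
  \<open>S\<close>. The second lets the fraction 1 - \<sigma> of \<tau> d absorb the Lipschitz error
  of the descent lemma, leaving \<sigma> \<tau> d as decrease.\<close>

lemma prox_step_sufficient_decrease:
  fixes \<phi> :: "'a::euclidean_space \<Rightarrow> real"
  assumes S: "convex S" "\<And>z. z \<in> S \<Longrightarrow> GDERIV \<phi> z :> G z" "L-lipschitz_on S G"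
    and x: "x \<in> S" "cball x \<delta> \<subseteq> S" and B: "norm (G x) \<le> B" "0 \<le> B"
    and d: "\<gamma> / 2 * (norm (y - x))\<^sup>2 \<le> d" and model: "G x \<bullet> (y - x) + \<tau> * d \<le> 0"
    and pos: "\<gamma> > 0" "\<delta> > 0" "\<tau> > 0"
    and large: "2 * B \<le> \<tau> * \<gamma> * \<delta>" "2 * L \<le> (1 - \<sigma>) * \<tau> * \<gamma>"
  shows "\<phi> y \<le> \<phi> x - \<sigma> * \<tau> * d"
proof -
  define n where "n = norm (y - x)"
  have "\<tau> * (\<gamma> / 2 * n\<^sup>2) \<le> \<tau> * d" using d pos by (simp add: n_def)
  also have "\<dots> \<le> - (G x \<bullet> (y - x))" using model by simp
  also have "\<dots> \<le> norm (G x) * n" using Cauchy_Schwarz_ineq2[of "G x" "y - x"] by (simp add: n_def)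
  also have "\<dots> \<le> B * n" using B by (intro mult_right_mono) (auto simp: n_def)
  finally have q: "\<tau> * \<gamma> / 2 * n * n \<le> B * n" by (simp add: power2_eq_square algebra_simps)
  have "n \<le> \<delta>"
  proof (rule ccontr)
    assume "\<not> n \<le> \<delta>"
    then have n: "\<delta> < n" "0 < n" using pos by auto
    then have "\<tau> * \<gamma> / 2 * n \<le> B" using q by simp
    moreover have "\<tau> * \<gamma> * \<delta> < \<tau> * \<gamma> * n" using n pos by simp
    ultimately show False using large(1) by simp
  qed
  then have "y \<in> S" using x(2) by (auto simp: n_def dist_norm norm_minus_commute)
  from lipschitz_gradient_upper_bound[OF S x(1) this]
  have "\<phi> y \<le> \<phi> x + G x \<bullet> (y - x) + L * n\<^sup>2" by (simp add: n_def)
  also have "L * n\<^sup>2 \<le> (1 - \<sigma>) * \<tau> * \<gamma> / 2 * n\<^sup>2"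
    using large(2) by (intro mult_right_mono) auto
  also have "\<dots> = (1 - \<sigma>) * \<tau> * (\<gamma> / 2 * n\<^sup>2)" by simp
  also have "\<dots> \<le> (1 - \<sigma>) * \<tau> * d"
  proof (intro mult_left_mono)
    \<comment> \<open>The sign is read off from the second \<open>large\<close> bound, whose
      left-hand side 2L is nonnegative.\<close>
    have "0 \<le> (1 - \<sigma>) * \<tau> * \<gamma>" using large(2) lipschitz_on_nonneg[OF S(3)] by linarith
    then show "0 \<le> (1 - \<sigma>) * \<tau>" using pos by (simp add: zero_le_mult_iff)
  qed (use d in \<open>simp add: n_def\<close>)
  finally have "\<phi> y \<le> \<phi> x + G x \<bullet> (y - x) + (1 - \<sigma>) * \<tau> * d" by simp
  with model show ?thesis by (simp add: algebra_simps)
qed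

theorem theorem3p3:
  fixes f :: "'n::finite symmat \<Rightarrow> ereal"
    and X :: "nat \<Rightarrow> 'n symmat"
    and Xstar :: "'n symmat"
    and \<gamma>1 \<gamma>2 :: "nat \<Rightarrow> real"
    and r \<gamma>min \<gamma>max \<beta> \<sigma> p :: real
  assumes "r > 1"
    and "\<gamma>min > 0" and "\<gamma>min \<le> \<gamma>max"
    and "\<And>k. \<gamma>1 k \<in> {\<gamma>min..\<gamma>max}"
    and "\<And>k. \<gamma>2 k \<in> {\<gamma>min..\<gamma>max}"
    and "\<And>Z. f Z \<noteq> -\<infinity>"
    and "continuously_differentiable_on f (interior (edomain f))"
    and "\<exists>m::real. \<forall>Z\<in>psd_cone. ereal m \<le> f Z"
    and "lower_semicontinuous f"
    and "pd_cone \<subseteq> interior (edomain f)"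
    and "edomain f \<inter> psd_cone \<subseteq> interior (edomain f)"
    and "locally_lipschitz_on (gradient f) (interior (edomain f))"
    and "\<beta> > 1" and "0 < \<sigma>" and "\<sigma> < 1" and "0 < p" and "p \<le> 1"
    and "GVDPGM_sequence f (indicator_inf psd_cone) pd_cone
           (\<lambda>k. logdet_distance r (\<gamma>1 k) (\<gamma>2 k)) \<beta> \<sigma> p X"
    and "\<exists>s :: nat \<Rightarrow> nat. strict_mono s \<and> (X \<circ> s) \<longlonglongrightarrow> Xstar"
  shows "Xstar \<in> edomain f \<inter> psd_cone \<and>
         0 \<in> frechet_subdifferential (\<lambda>Z. f Z + indicator_inf psd_cone Z) Xstar"
proof -
  define U where "U = interior (edomain f)"
  define \<phi> where "\<phi> Z = real_of_ereal (f Z)" for Z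
  define G where "G = gradient f"
  let ?d = "\<lambda>k. logdet_real r (\<gamma>1 k) (\<gamma>2 k)"
  have \<gamma>1: "\<gamma>min \<le> \<gamma>1 k" "\<gamma>1 k \<le> \<gamma>max" "0 \<le> \<gamma>1 k" for k
    using assms(4)[of k] assms(2) by auto
  have \<gamma>2: "\<gamma>min \<le> \<gamma>2 k" "\<gamma>2 k \<le> \<gamma>max" "0 \<le> \<gamma>2 k" for k
    using assms(5)[of k] assms(2) by auto
  have \<phi>: "f Z = ereal (\<phi> Z)" if "Z \<in> U" for Z
    using that assms(6)[of Z] interior_subset[of "edomain f"] unfolding U_def \<phi>_def
    by (cases "f Z") (auto simp: edomain_def)
  have pdU: "Z \<in> U" if "Z \<in> pd_cone" for Z using that assms(10) by (auto simp: U_def)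
  have der: "GDERIV \<phi> Z :> G Z" if "Z \<in> U" for Z
    using continuously_differentiable_on_GDERIV[OF assms(7)] that by (simp add: U_def G_def \<phi>_def[abs_def])
  have contG: "continuous_on U G"
    using assms(7) by (simp add: continuously_differentiable_on_def U_def G_def)
  obtain v xt bt where Xpd: "\<And>k. X k \<in> pd_cone" and \<phi>v: "\<And>k. \<phi> (X k) \<le> v k"
    and vdec: "\<And>k. v (Suc k) \<le> v k - p * (\<sigma> * \<beta> ^ bt k * ?d k (X (Suc k)) (X k))"
    and XS: "\<And>k. X (Suc k) = xt k (bt k)"
    and argmin: "\<And>k i. i \<le> bt k \<Longrightarrow> is_arg_min (prox_grad_model f (indicator_inf psd_cone)
            (logdet_distance r (\<gamma>1 k) (\<gamma>2 k)) (\<beta> ^ i) (X k)) (\<lambda>_. True) (xt k i)"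
    and fail: "\<And>k i. i < bt k \<Longrightarrow> v k - \<sigma> * \<beta> ^ i * ?d k (xt k i) (X k) < \<phi> (xt k i)"
    by (rule GVDPGM_logdet_invariants[OF \<gamma>1(3) \<gamma>2(3) \<phi>[OF pdU] assms(13,14,16,18)]) (assumption, rule that)
  have step: "xt k i \<in> pd_cone" "G (X k) \<bullet> (xt k i - X k) + \<beta> ^ i * ?d k (xt k i) (X k) \<le> 0"
      "G (X k) \<bullet> H + \<beta> ^ i * (\<gamma>1 k * det (mat_of (X k)) powr r *
          (trace (mat_of H ** matrix_inv (mat_of (X k))) - trace (mat_of H ** matrix_inv (mat_of (xt k i))))
          + \<gamma>2 k * ((xt k i - X k) \<bullet> H)) = 0"
    if "i \<le> bt k" for k i H
    using logdet_prox_step[OF Xpd \<phi>[OF pdU[OF Xpd]] _ argmin[OF that]] assms(13) by (auto simp: G_def)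
  have d_ge: "\<gamma>min / 2 * (norm (Z - X k))\<^sup>2 \<le> ?d k Z (X k)" if "Z \<in> pd_cone" for k Z
  proof -
    have "\<gamma>min / 2 * (norm (Z - X k))\<^sup>2 \<le> \<gamma>2 k / 2 * (norm (Z - X k))\<^sup>2"
      using \<gamma>2[of k] by (intro mult_right_mono) auto
    also have "\<dots> \<le> ?d k Z (X k)" using logdet_real_ge[OF that Xpd \<gamma>1(3)] .
    finally show ?thesis .
  qed

  \<comment> \<open>Convergent reference values and vanishing steps\<close>
  have \<beta>1: "1 \<le> \<beta> ^ i" for i :: nat using assms(13) by simp
  have v_step: "v (Suc k) \<le> v k - p * \<sigma> * \<gamma>min / 2 * (norm (X (Suc k) - X k))\<^sup>2" for k
  proof -
    have "\<gamma>min / 2 * (norm (X (Suc k) - X k))\<^sup>2 \<le> \<beta> ^ bt k * ?d k (X (Suc k)) (X k)"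
      using mult_mono[OF \<beta>1[of "bt k"] d_ge[OF Xpd[of "Suc k"], of k]] assms(2,13) by simp
    then have "p * \<sigma> * (\<gamma>min / 2 * (norm (X (Suc k) - X k))\<^sup>2) \<le> p * \<sigma> * (\<beta> ^ bt k * ?d k (X (Suc k)) (X k))"
      using assms(14,16) by (intro mult_left_mono) auto
    then show ?thesis using vdec[of k] by (simp add: algebra_simps)
  qed
  have v_mono: "decseq v"
  proof (rule decseq_SucI)
    fix k
    have "0 \<le> p * \<sigma> * \<gamma>min / 2 * (norm (X (Suc k) - X k))\<^sup>2" using assms(2,14,16) by simp
    then show "v (Suc k) \<le> v k" using v_step[of k] by linarith
  qed
  obtain m where m: "\<And>Z. Z \<in> psd_cone \<Longrightarrow> ereal m \<le> f Z" using assms(8) by blast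
  have "m \<le> v k" for k
    using m[of "X k"] \<phi>v[of k] Xpd[of k] pd_cone_subset_psd_cone \<phi>[OF pdU[OF Xpd[of k]]] by auto
  then obtain vl where vl: "v \<longlonglongrightarrow> vl" using decseq_convergent[OF v_mono] by blast
  have "(\<lambda>k. norm (X (Suc k) - X k)) \<longlonglongrightarrow> 0"
  proof -
    define c where "c = p * \<sigma> * \<gamma>min / 2"
    have c: "c > 0" using assms(2,14,16) by (simp add: c_def)
    \<comment> \<open>Each squared step is at most 1/c times one decrement of the convergent
      sequence \<open>v\<close>.\<close>
    have "(\<lambda>k. (v k - v (Suc k)) / c) \<longlonglongrightarrow> (vl - vl) / c"
      using c by (intro tendsto_intros vl LIMSEQ_Suc[OF vl]) auto
    then have "(\<lambda>k. (v k - v (Suc k)) / c) \<longlonglongrightarrow> 0" by simp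
    then have "(\<lambda>k. (norm (X (Suc k) - X k))\<^sup>2) \<longlonglongrightarrow> 0"
    proof (rule tendsto_sandwich[rotated -1])
      show "\<forall>\<^sub>F k in sequentially. (norm (X (Suc k) - X k))\<^sup>2 \<le> (v k - v (Suc k)) / c"
      proof (intro always_eventually allI)
        fix k
        show "(norm (X (Suc k) - X k))\<^sup>2 \<le> (v k - v (Suc k)) / c"
          using v_step[of k] c unfolding c_def[symmetric] by (simp add: field_simps)
      qed
    qed auto
    then have "(\<lambda>k. sqrt ((norm (X (Suc k) - X k))\<^sup>2)) \<longlonglongrightarrow> sqrt 0" by (rule tendsto_real_sqrt)
    then show ?thesis by simp
  qed
  then have Xdiff: "(\<lambda>k. X (Suc k) - X k) \<longlonglongrightarrow> 0" by (rule tendsto_norm_zero_cancel)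
  obtain s where s: "strict_mono s" and Xs: "(\<lambda>j. X (s j)) \<longlonglongrightarrow> Xstar"
    using assms(19) by (auto simp: o_def)
  have diff_s: "(\<lambda>j. X (Suc (s j)) - X (s j)) \<longlonglongrightarrow> 0"
    using LIMSEQ_subseq_LIMSEQ[OF Xdiff s] by (simp add: o_def)
  have XSs: "(\<lambda>j. X (Suc (s j))) \<longlonglongrightarrow> Xstar"
    using tendsto_add[OF diff_s Xs] by simp

  \<comment> \<open>Feasibility of the accumulation point\<close>
  have psd_star: "Xstar \<in> psd_cone"
    using closed_sequentially[OF closed_psd_cone _ Xs] Xpd pd_cone_subset_psd_cone by blast
  \<comment> \<open>All iterates lie in one sublevel set, so lower semicontinuity keeps
    \<open>f Xstar\<close> finite; the domain assumption on the cone then puts \<open>Xstar\<close>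
    in the interior, even when it is singular.\<close>
  have "f (X k) \<le> ereal (v 0)" for k
    using \<phi>v[of k] decseqD[OF v_mono, of 0 k] \<phi>[OF pdU[OF Xpd[of k]]] by simp
  then have "f Xstar \<le> ereal (v 0)"
    by (intro lower_semicontinuous_limit_le[OF assms(9) Xs])
  then have dom_star: "Xstar \<in> edomain f" by (auto simp: edomain_def)
  with psd_star have star_U: "Xstar \<in> U" using assms(11) by (auto simp: U_def)

  \<comment> \<open>Bounded backtracking near the accumulation point\<close>
  obtain N where N: "\<forall>\<^sub>F j in sequentially. bt (s j) \<le> N"
  proof -
    obtain u0 L where u0: "u0 > 0" "L-lipschitz_on (cball Xstar u0 \<inter> U) G"
      using assms(12) star_U unfolding locally_lipschitz_on_def G_def U_def by blast
    obtain u1 where u1: "u1 > 0" "cball Xstar u1 \<subseteq> U"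
      using star_U open_contains_cball[of U] by (auto simp: U_def)
    define u where "u = min u0 u1"
    define S where "S = cball Xstar u"
    have u: "u > 0" using u0(1) u1(1) by (simp add: u_def)
    have "S \<subseteq> cball Xstar u1" "S \<subseteq> cball Xstar u0" by (auto simp: S_def u_def)
    with u1(2) have SU: "S \<subseteq> U" and SL: "L-lipschitz_on S G"
      by (auto intro!: lipschitz_on_subset[OF u0(2), of S])
    define B where "B = norm (G Xstar) + L * u"
    have L0: "0 \<le> L" using lipschitz_on_nonneg[OF SL] .
    then have B0: "0 \<le> B" using u by (simp add: B_def)
    have GB: "norm (G Z) \<le> B" if "Z \<in> S" for Z
    proof -
      have "norm (G Z - G Xstar) \<le> L * norm (Z - Xstar)"
        using lipschitz_onD[OF SL that, of Xstar] u by (simp add: S_def dist_norm)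
      also have "\<dots> \<le> L * u"
        using that L0 by (intro mult_left_mono) (auto simp: S_def dist_norm norm_minus_commute)
      finally show ?thesis using norm_triangle_sub[of "G Z" "G Xstar"] by (simp add: B_def)
    qed
    \<comment> \<open>The two entries are the thresholds in the \<open>large\<close> bounds, with
      \<delta> = u/2 and \<gamma> = \<open>\<gamma>min\<close>, so \<open>N\<close> does not depend
      on the iterate.\<close>
    define T where "T = max (2 * B / (\<gamma>min * (u / 2))) (2 * L / ((1 - \<sigma>) * \<gamma>min))"
    obtain N where N: "T < \<beta> ^ N" using real_arch_pow[OF assms(13)] by blast
    have large: "2 * B \<le> \<beta> ^ N * \<gamma>min * (u / 2)" "2 * L \<le> (1 - \<sigma>) * \<beta> ^ N * \<gamma>min"
      using N assms(2,15) u by (auto simp: T_def field_simps)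
    have "\<forall>\<^sub>F j in sequentially. X (s j) \<in> ball Xstar (u / 2)"
      using Xs u by (intro topological_tendstoD) auto
    then have "\<forall>\<^sub>F j in sequentially. bt (s j) \<le> N"
    proof eventually_elim
      case (elim j)
      show ?case
      proof (rule ccontr)
        \<comment> \<open>Otherwise trial \<open>N\<close> was computed and rejected. The decrease
          estimate shows that it meets the test against \<phi>(X_k), hence also against the larger
          reference value.\<close>
        assume "\<not> bt (s j) \<le> N"
        then have less: "N < bt (s j)" and le: "N \<le> bt (s j)" by auto
        have XjS: "X (s j) \<in> S" using elim u by (auto simp: S_def)
        have ball: "cball (X (s j)) (u / 2) \<subseteq> S"
          using elim by (auto simp: S_def cball_subset_cball_iff dist_commute)
        have "\<phi> (xt (s j) N) \<le> \<phi> (X (s j)) - \<sigma> * \<beta> ^ N * ?d (s j) (xt (s j) N) (X (s j))"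
          by (rule prox_step_sufficient_decrease[OF _ _ SL XjS ball GB[OF XjS] B0
              d_ge[OF step(1)[OF le]] step(2)[OF le] assms(2) _ _ large])
            (use SU der u assms(13) in \<open>auto simp: S_def\<close>)
        with fail[OF less] \<phi>v[of "s j"] show False by linarith
      qed
    qed
    then show thesis by (rule that)
  qed

  \<comment> \<open>The variational inequality in the limit\<close>
  have "0 \<le> G Xstar \<bullet> (Z - Xstar)" if Z: "Z \<in> psd_cone" for Z
  proof -
    obtain w where w: "w \<longlonglongrightarrow> 0" and w_ge: "\<And>j. det (mat_of (X (s j))) powr r *
        (trace (mat_of (Z - X (Suc (s j))) ** matrix_inv (mat_of (X (s j))))
           - trace (mat_of (Z - X (Suc (s j))) ** matrix_inv (mat_of (X (Suc (s j)))))) \<le> w j"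
      using logdet_slope_bound[OF Xpd Xs Xpd XSs Z assms(1)] by blast
    define q where "q j = (X (Suc (s j)) - X (s j)) \<bullet> (Z - X (Suc (s j)))" for j
    have "q \<longlonglongrightarrow> 0 \<bullet> (Z - Xstar)"
      unfolding q_def by (intro tendsto_intros diff_s XSs)
    then have q: "q \<longlonglongrightarrow> 0" by simp
    \<comment> \<open>\<open>\<beta> ^ N * \<gamma>max\<close> bounds every product of step
      parameter and weight; absolute values are taken because \<open>w\<close> and \<open>q\<close>
      may have either sign.\<close>
    define e where "e j = - (\<beta> ^ N * \<gamma>max * (\<bar>w j\<bar> + \<bar>q j\<bar>))" for j
    have "e \<longlonglongrightarrow> - (\<beta> ^ N * \<gamma>max * (\<bar>0\<bar> + \<bar>0\<bar>))"
      unfolding e_def by (intro tendsto_intros w q)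
    then have e: "e \<longlonglongrightarrow> 0" by simp
    have "(\<lambda>j. G (X (s j)) \<bullet> (Z - X (Suc (s j)))) \<longlonglongrightarrow> G Xstar \<bullet> (Z - Xstar)"
    proof (intro tendsto_intros XSs)
      show "(\<lambda>j. G (X (s j))) \<longlonglongrightarrow> G Xstar"
        using continuous_on_tendsto_compose[OF contG Xs star_U] pdU[OF Xpd] by simp
    qed
    moreover have "\<forall>\<^sub>F j in sequentially. e j \<le> G (X (s j)) \<bullet> (Z - X (Suc (s j)))"
      using N
    proof eventually_elim
      case (elim j)
      let ?k = "s j"
      let ?\<tau> = "\<beta> ^ bt ?k"
      have \<tau>: "?\<tau> \<le> \<beta> ^ N" "0 \<le> ?\<tau>" using elim assms(13) by (auto intro: power_increasing)
      have *: "?\<tau> * \<gamma> * a \<le> \<beta> ^ N * \<gamma>max * \<bar>a\<bar>" if "0 \<le> \<gamma>" "\<gamma> \<le> \<gamma>max" for \<gamma> a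
      proof -
        have "?\<tau> * \<gamma> * a \<le> ?\<tau> * \<gamma> * \<bar>a\<bar>" using that \<tau> by (intro mult_left_mono) auto
        also have "\<dots> \<le> \<beta> ^ N * \<gamma>max * \<bar>a\<bar>" using that \<tau> by (intro mult_right_mono mult_mono) auto
        finally show ?thesis .
      qed
      let ?t = "det (mat_of (X ?k)) powr r *
        (trace (mat_of (Z - X (Suc ?k)) ** matrix_inv (mat_of (X ?k)))
           - trace (mat_of (Z - X (Suc ?k)) ** matrix_inv (mat_of (X (Suc ?k)))))"
      have "?\<tau> * \<gamma>1 ?k * ?t \<le> ?\<tau> * \<gamma>1 ?k * w j"
        using \<gamma>1[of ?k] \<tau> by (intro mult_left_mono w_ge) auto
      \<comment> \<open>The stationarity equation of the accepted trial point, tested with Z -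
        X_{k+1} and solved for the gradient term; an upper bound on \<open>?t\<close> becomes a
        lower bound here.\<close>
      moreover have "G (X ?k) \<bullet> (Z - X (Suc ?k)) = - (?\<tau> * \<gamma>1 ?k * ?t) - ?\<tau> * \<gamma>2 ?k * q j"
        using step(3)[of "bt ?k" ?k "Z - X (Suc ?k)"] by (simp add: XS q_def algebra_simps)
      ultimately show ?case
        using *[OF \<gamma>1(3,2), of ?k "w j"] *[OF \<gamma>2(3,2), of ?k "q j"]
        by (simp add: e_def distrib_left)
    qed
    ultimately show ?thesis by (intro tendsto_le[OF sequentially_bot _ e])
  qed
  then have "0 \<in> frechet_subdifferential (\<lambda>Z. f Z + indicator_inf psd_cone Z) Xstar"
    using star_U der[OF star_U] assms(6) psd_star
    by (intro zero_in_frechet_subdifferential_indicator) (auto simp: U_def \<phi>_def[abs_def])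
  with dom_star psd_star show ?thesis by blast
qed

end
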